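(* Let $R$ be a finite commutative ring with unity, written as $R = R_1\times\cdots\times R_s$ with $R_i$ finite local rings, let $x = (x_1,\dots,x_s)$ be a nonzero element of $R$, and let $P = \{ i \in\{1,\dots,s\} : x_i \neq 0\}$. Then the energy of the complement $\overline{\mathrm{Cay}(R, xR^* )}$ is $$2(|R| - |xR^*| - 1) + \frac{|R|}{|I_x|}\left[2^{|P|}|xR^*| + \prod_{i\in P}\left(1 - \frac{|x_iR_i^*|}{|M_{x_i}|}\right) - \prod_{i\in P}\left(1 + \frac{|x_iR_i^*|}{|M_{x_i}|}\right)\right].$$
   Context: For a finite commutative ring $S$ with unity, $S^*$ is its unit group and $yS^*=\{yr : r\in S^*\}$. $\mathrm{Cay}(R, xR^* )$ is the (loopless) graph with vertex set $R$ in which $u,v$ are adjacent iff $u-v\in xR^*$. The complement $\overline{G}$ of a loopless graph $G$ is the loopless graph on the same vertex set in which two distinct vertices are adjacent iff they are not adjacent in $G$. $I_x$ is the ideal of $R$ generated by $x$; $I_{x_i}$ is the ideal of $R_i$ generated by $x_i$ and $M_{x_i} = I_{x_i}\setminus x_iR_i^*$. The energy of a graph is the sum of the absolute values of the eigenvalues of its $(0,1)$-adjacency matrix, with multiplicity. *)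

theory Defs
  imports
    "HOL-Algebra.Chinese_Remainder"
    "HOL-Algebra.Ideal"
    "Jordan_Normal_Form.Char_Poly"
    "Graph_Theory.Pair_Digraph"
begin

locale local_ring = cring +
  assumes unique_maximal_ideal: "\<exists>!M. maximalideal M R"

definition unit_multiples :: "('a, 'm) ring_scheme \<Rightarrow> 'a \<Rightarrow> 'a set"
  where "unit_multiples R y = {y \<otimes>\<^bsub>R\<^esub> r | r. r \<in> Units R}"

(* The ideal generated by y, without the elements y * r for units r. *)
definition nongenerators :: "('a, 'm) ring_scheme \<Rightarrow> 'a \<Rightarrow> 'a set"
  where "nongenerators R y = (Idl\<^bsub>R\<^esub> {y}) - unit_multiples R y"

(* Undirected graphs are pair_pre_digraphs with a symmetric arc relation. *)

definition cayley_graph :: "('a, 'm) ring_scheme \<Rightarrow> 'a set \<Rightarrow> 'a pair_pre_digraph"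
  where "cayley_graph R S =
    \<lparr> pverts = carrier R,
      parcs = {(u, v). u \<in> carrier R \<and> v \<in> carrier R \<and> u \<ominus>\<^bsub>R\<^esub> v \<in> S} \<rparr>"

definition graph_complement :: "'a pair_pre_digraph \<Rightarrow> 'a pair_pre_digraph"
  where "graph_complement G =
    \<lparr> pverts = pverts G,
      parcs = {(u, v). u \<in> pverts G \<and> v \<in> pverts G \<and> u \<noteq> v \<and> (u, v) \<notin> parcs G} \<rparr>"

definition adjacency_matrix :: "'a pair_pre_digraph \<Rightarrow> 'a list \<Rightarrow> complex mat"
  where "adjacency_matrix G vs =
    mat (length vs) (length vs) (\<lambda>(i, j). if (vs ! i, vs ! j) \<in> parcs G then 1 else 0)"

(* Sum of the absolute values of all complex eigenvalues, counted with algebraic multiplicity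
   (for a Hermitian matrix this is also the geometric multiplicity). *)
definition matrix_energy :: "complex mat \<Rightarrow> real"
  where "matrix_energy A =
    (\<Sum>e\<in>{e. eigenvalue A e}. real (Polynomial.order e (char_poly A)) * cmod e)"

(* The choice of the vertex enumeration is immaterial, see graph_energy_eq below. *)
definition graph_energy :: "'a pair_pre_digraph \<Rightarrow> real"
  where "graph_energy G =
    matrix_energy (adjacency_matrix G (SOME vs. distinct vs \<and> set vs = pverts G))"

lemma matrix_energy_similar:
  assumes "similar_mat A B"
  shows "matrix_energy A = matrix_energy B"
proof -
  obtain n where n: "A \<in> carrier_mat n n" "B \<in> carrier_mat n n"
    using similar_matD[OF assms] by blast
  have "char_poly A = char_poly B" using assms by (rule char_poly_similar)
  moreover from this have "eigenvalue A = eigenvalue B"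
    by (intro ext) (simp add: n[THEN eigenvalue_root_char_poly])
  ultimately show ?thesis unfolding matrix_energy_def by simp
qed

lemma adjacency_matrix_similar:
  assumes d: "distinct vs" "distinct ws" and s: "set vs = set ws"
  shows "similar_mat (adjacency_matrix G vs) (adjacency_matrix G ws)"
proof -
  define n where "n = length vs"
  have n': "length ws = n" using distinct_card[OF d(1)] distinct_card[OF d(2)] s by (simp add: n_def)
  define P :: "complex mat" where "P = mat n n (\<lambda>(i, j). if vs ! i = ws ! j then 1 else 0)"
  define Q :: "complex mat" where "Q = mat n n (\<lambda>(i, j). if ws ! i = vs ! j then 1 else 0)"
  have PQ: "P \<in> carrier_mat n n" "Q \<in> carrier_mat n n" by (auto simp: P_def Q_def)
  define A where "A = adjacency_matrix G vs"
  define B where "B = adjacency_matrix G ws"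
  have AB: "A \<in> carrier_mat n n" "B \<in> carrier_mat n n"
    by (auto simp: A_def B_def adjacency_matrix_def n_def n'[unfolded n_def])
  have "\<forall>i. \<exists>m. i < n \<longrightarrow> m < n \<and> ws ! m = vs ! i"
  proof (intro allI)
    fix i
    have "vs ! i \<in> set ws" if "i < n" using that unfolding s[symmetric] n_def by (rule nth_mem)
    then show "\<exists>m. i < n \<longrightarrow> m < n \<and> ws ! m = vs ! i"
      unfolding in_set_conv_nth n' by blast
  qed
  from choice[OF this] obtain k where k: "\<And>i. i < n \<Longrightarrow> k i < n \<and> ws ! k i = vs ! i" by blast
  have eq_iff: "vs ! i = ws ! j \<longleftrightarrow> j = k i" if "i < n" "j < n" for i j
    using k[OF that(1)] that(2) n' nth_eq_iff_index_eq[OF d(2), of j "k i"] by auto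
  have P: "P $$ (i, j) = (if j = k i then 1 else 0)" if "i < n" "j < n" for i j
    using that eq_iff by (simp add: P_def)
  have Q: "Q $$ (j, i) = (if j = k i then 1 else 0)" if "i < n" "j < n" for i j
    using that eq_iff[OF that] by (auto simp: Q_def)
  have inj: "k i = k j \<longleftrightarrow> i = j" if "i < n" "j < n" for i j
    using k[OF that(1)] k[OF that(2)] that nth_eq_iff_index_eq[OF d(1), of i j]
    by (fold n_def) metis
  have "P * Q = 1\<^sub>m n"
  proof (rule eq_matI)
    fix i j assume ij: "i < dim_row (1\<^sub>m n)" "j < dim_col (1\<^sub>m n)"
    hence ij': "i < n" "j < n" by auto
    have "(P * Q) $$ (i, j) = (\<Sum>l\<in>{0..<n}. P $$ (i, l) * Q $$ (l, j))"
      using ij' PQ by (simp add: scalar_prod_def)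
    also have "\<dots> = (\<Sum>l\<in>{0..<n}. if l = k i then (if k i = k j then 1 else 0) else 0)"
      using ij' by (intro sum.cong) (auto simp: P Q)
    also have "\<dots> = (if i = j then 1 else 0)"
      using k ij' by (simp add: inj)
    finally show "(P * Q) $$ (i, j) = 1\<^sub>m n $$ (i, j)" using ij' by simp
  qed (use PQ in auto)
  moreover from this have "Q * P = 1\<^sub>m n"
    using PQ mat_mult_left_right_inverse by blast
  moreover have "A = P * B * Q"
  proof (rule eq_matI)
    fix i j assume ij: "i < dim_row (P * B * Q)" "j < dim_col (P * B * Q)"
    hence ij': "i < n" "j < n" using PQ by auto
    have PB: "(P * B) $$ (i, l) = B $$ (k i, l)" if "l < n" for l
    proof -
      have "(P * B) $$ (i, l) = (\<Sum>m\<in>{0..<n}. P $$ (i, m) * B $$ (m, l))"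
        using ij' that PQ AB by (simp add: scalar_prod_def)
      also have "\<dots> = (\<Sum>m\<in>{0..<n}. if m = k i then B $$ (k i, l) else 0)"
        using ij' by (intro sum.cong) (auto simp: P)
      also have "\<dots> = B $$ (k i, l)" using k ij' by simp
      finally show ?thesis .
    qed
    have "(P * B * Q) $$ (i, j) = (\<Sum>l\<in>{0..<n}. (P * B) $$ (i, l) * Q $$ (l, j))"
      using ij' PQ AB by (simp add: scalar_prod_def del: assoc_mult_mat)
    also have "\<dots> = (\<Sum>l\<in>{0..<n}. if l = k j then B $$ (k i, k j) else 0)"
      using ij' by (intro sum.cong) (auto simp: PB Q simp del: index_mult_mat)
    also have "\<dots> = B $$ (k i, k j)" using k ij' by simp
    also have "\<dots> = A $$ (i, j)"
      using k ij' n' by (simp add: A_def B_def adjacency_matrix_def flip: n_def)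
    finally show "A $$ (i, j) = (P * B * Q) $$ (i, j)" by simp
  qed (use PQ AB in auto)
  ultimately have "similar_mat_wit A B P Q"
    using PQ AB by (intro similar_mat_witI)
  thus ?thesis unfolding similar_mat_def A_def B_def by blast
qed

lemma graph_energy_eq:
  assumes "distinct vs" "set vs = pverts G"
  shows "graph_energy G = matrix_energy (adjacency_matrix G vs)"
proof -
  define ws where "ws = (SOME vs. distinct vs \<and> set vs = pverts G)"
  have "distinct ws \<and> set ws = pverts G"
    unfolding ws_def by (rule someI[of _ vs]) (use assms in simp)
  then show ?thesis unfolding graph_energy_def ws_def[symmetric]
    using assms by (intro matrix_energy_similar adjacency_matrix_similar) auto
qed

(* Loops are excluded because x is nonzero, and adjacency is symmetric because -1 is a unit. *)
lemma cayley_graph_pair_graph: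
  fixes R (structure)
  assumes "cring R" "finite (carrier R)" "x \<in> carrier R" "x \<noteq> \<zero>\<^bsub>R\<^esub>"
  shows "pair_graph (cayley_graph R (unit_multiples R x))"
proof -
  interpret cring R by fact
  let ?G = "cayley_graph R (unit_multiples R x)"
  have sym: "v \<ominus> u \<in> unit_multiples R x"
    if uv: "u \<ominus> v \<in> unit_multiples R x" and "u \<in> carrier R" "v \<in> carrier R" for u v
  proof -
    obtain r where r: "r \<in> Units R" "u \<ominus> v = x \<otimes> r"
      using uv by (auto simp: unit_multiples_def)
    have "v \<ominus> u = \<ominus> (u \<ominus> v)" using that by (simp add: minus_eq minus_add a_comm)
    also have "\<dots> = x \<otimes> (\<ominus> r)" using r assms(3) by (simp add: r_minus Units_closed)
    finally have "v \<ominus> u = x \<otimes> (\<ominus> r)" .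
    moreover have "\<ominus> r \<in> Units R"
    proof -
      have "\<ominus> r = (\<ominus> \<one>) \<otimes> r" using r(1) by (simp add: l_minus Units_closed)
      then show ?thesis using r(1) Units_minus_one_closed by simp
    qed
    ultimately show ?thesis by (auto simp: unit_multiples_def)
  qed
  have loop: "u \<ominus> u \<notin> unit_multiples R x" if u: "u \<in> carrier R" for u
  proof
    assume "u \<ominus> u \<in> unit_multiples R x"
    then obtain r where r: "r \<in> Units R" "\<zero> = x \<otimes> r"
      using u by (auto simp: unit_multiples_def minus_eq r_neg)
    have "x = x \<otimes> r \<otimes> inv r" using r(1) assms(3) by (simp add: m_assoc Units_closed)
    also have "\<dots> = \<zero>" using r(1) unfolding r(2)[symmetric] by simp
    finally show False using assms(4) by simp
  qed
  show ?thesis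
  proof
    show "finite (parcs ?G)"
      by (rule finite_subset[of _ "carrier R \<times> carrier R"])
        (use assms(2) in \<open>auto simp: cayley_graph_def\<close>)
    show "symmetric ?G"
      unfolding symmetric_def by (rule symI) (auto simp: cayley_graph_def intro: sym)
  qed (use loop assms(2) in \<open>auto simp: cayley_graph_def\<close>)
qed

end

(*
  A is the tensor product of the adjacency kernels of the factors. For x_i nonzero, the kernel of
  the i-th factor is |I| e_I - |M| e_M, where I = I_{x_i}, M = M_{x_i} is an additive subgroup, and
  e_H(u, v) = [u - v in H] / |H| is idempotent with e_H e_K = e_H for K contained in H; hence its
  eigenvalues are |I| - |M| = |x_i R_i^*|, -|M| and 0. The complement has adjacency matrix J - 1 - A,
  and J / n is one more idempotent. Its energy is therefore, up to the contribution of J, a sum of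
  |1 + l| over the eigenvalues l of A. These are integers, so |1 + l| = 1 + |l| + sgn l - |sgn l|,
  and each of the four resulting sums factors over i.
*)
theory Submission
  imports Defs "Jordan_Normal_Form.Schur_Decomposition"
begin

section \<open>Energy of a combination of orthogonal idempotents\<close>

text \<open>The energy is defined through algebraic multiplicities of roots of the characteristic
  polynomial, so a decomposition into idempotents has to be turned into a statement about these
  roots. Traces do this without eigenspaces or ranks: the trace of a power is a power sum of the
  roots, and the trace of an idempotent stands in for its multiplicity. These traces, such as
  \<open>|R| / |H|\<close> for \<open>e_H\<close>, remain quotients throughout. The obstacle is that
  \<open>1 + l\<close> does not factor when \<open>l\<close> is a product over the factors; cutting
  its absolute value into multiplicative pieces produces one product formula per piece. For
  \<open>x_i\<close> nonzero, the eigenvalues \<open>|x_i R_i^*|\<close> and \<open>-|M|\<close>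
  have multiplicities in the ratio \<open>1 : q\<close> with \<open>q = |x_i R_i^*| / |M|\<close>.
  Hence \<open>sgn l\<close> and \<open>|sgn l|\<close> give the factors \<open>1 - q\<close> and
  \<open>1 + q\<close>, and \<open>|l|\<close> gives a factor 2 because the trace is zero. The
  summand 1 gives \<open>|R|\<close>, which together with the correction caused by \<open>J\<close>
  becomes \<open>2(|R| - |xR^*| - 1)\<close>.\<close>

definition mat_trace :: "'a::comm_ring_1 mat \<Rightarrow> 'a"
  where "mat_trace A = (\<Sum>i<dim_row A. A $$ (i, i))"

lemma mat_trace_mult_comm:
  assumes "A \<in> carrier_mat n m" "B \<in> carrier_mat m n"
  shows "mat_trace (A * B) = mat_trace (B * A)"
proof -
  have "mat_trace (A * B) = (\<Sum>i<n. \<Sum>j<m. A $$ (i, j) * B $$ (j, i))"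
    using assms by (simp add: mat_trace_def scalar_prod_def atLeast0LessThan)
  also have "\<dots> = (\<Sum>j<m. \<Sum>i<n. B $$ (j, i) * A $$ (i, j))"
    by (subst sum.swap) (simp add: mult.commute)
  also have "\<dots> = mat_trace (B * A)"
    using assms by (simp add: mat_trace_def scalar_prod_def atLeast0LessThan)
  finally show ?thesis .
qed

lemma mat_trace_similar:
  assumes "similar_mat_wit A B P Q"
  shows "mat_trace A = mat_trace B"
proof -
  define n where "n = dim_row A"
  note wit = similar_mat_witD[OF n_def assms]
  have "mat_trace A = mat_trace (P * (B * Q))"
    using wit by simp
  also have "\<dots> = mat_trace ((B * Q) * P)"
    by (rule mat_trace_mult_comm[of _ n n]) (use wit in auto)
  also have "(B * Q) * P = B"
    using wit by simp
  finally show ?thesis .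
qed

text \<open>Both claims go through one induction: triangularity of the lower power is what leaves
  only the term \<open>l = i\<close> in a diagonal entry of the product.\<close>

lemma upper_triangular_pow:
  fixes A :: "'a::comm_ring_1 mat"
  assumes "A \<in> carrier_mat n n" "upper_triangular A"
  shows "upper_triangular (A ^\<^sub>m k) \<and> (\<forall>i<n. (A ^\<^sub>m k) $$ (i, i) = A $$ (i, i) ^ k)"
proof (induction k)
  case 0
  show ?case using assms by auto
next
  case (Suc k)
  have dim: "A ^\<^sub>m k \<in> carrier_mat n n" using assms by simp
  have entry: "(A ^\<^sub>m Suc k) $$ (i, j) = (\<Sum>l\<in>{0..<n}. (A ^\<^sub>m k) $$ (i, l) * A $$ (l, j))"
    if "i < n" "j < n" for i j
    using that dim assms(1) by (simp add: scalar_prod_def)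
  have zero: "(A ^\<^sub>m k) $$ (i, l) * A $$ (l, j) = 0" if "l < i \<or> j < l" "i < n" "l < n" for i j l
  proof (cases "l < i")
    case True
    then have "(A ^\<^sub>m k) $$ (i, l) = 0"
      using that Suc dim by (intro upper_triangularD) auto
    then show ?thesis by simp
  next
    case False
    then have "A $$ (l, j) = 0"
      using that assms by (intro upper_triangularD) auto
    then show ?thesis by simp
  qed
  have "(A ^\<^sub>m Suc k) $$ (i, j) = 0" if "j < i" "i < n" for i j
  proof -
    have "(\<Sum>l\<in>{0..<n}. (A ^\<^sub>m k) $$ (i, l) * A $$ (l, j)) = 0"
      by (rule sum.neutral) (use that in \<open>auto intro!: zero\<close>)
    with that show ?thesis by (simp del: pow_mat.simps add: entry)
  qed
  moreover have "(A ^\<^sub>m Suc k) $$ (i, i) = A $$ (i, i) ^ Suc k" if "i < n" for i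
  proof -
    have "(\<Sum>l\<in>{0..<n}. (A ^\<^sub>m k) $$ (i, l) * A $$ (l, i))
        = (\<Sum>l\<in>{i}. (A ^\<^sub>m k) $$ (i, l) * A $$ (l, i))"
    proof (rule sum.mono_neutral_right)
      show "\<forall>l\<in>{0..<n} - {i}. (A ^\<^sub>m k) $$ (i, l) * A $$ (l, i) = 0"
      proof
        fix l assume "l \<in> {0..<n} - {i}"
        then show "(A ^\<^sub>m k) $$ (i, l) * A $$ (l, i) = 0"
          using that by (intro zero) auto
      qed
    qed (use that in auto)
    with that Suc show ?thesis by (simp del: pow_mat.simps add: entry)
  qed
  ultimately show ?case using dim assms(1) by auto
qed

text \<open>Schur form suffices: the trace is invariant under similarity, and the diagonal of the
  triangular \<open>B\<close> lists \<open>es\<close> and is raised to powers entrywise.\<close>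

lemma mat_trace_pow:
  fixes A :: "complex mat"
  assumes "A \<in> carrier_mat n n" "char_poly A = (\<Prod>e\<leftarrow>es. [:- e, 1:])"
  shows "mat_trace (A ^\<^sub>m k) = (\<Sum>e\<leftarrow>es. e ^ k)"
proof -
  obtain B P Q where "schur_decomposition A es = (B, P, Q)"
    using prod_cases3 by blast
  from schur_decomposition[OF assms this]
  have sim: "similar_mat_wit A B P Q" and ut: "upper_triangular B" and diag: "diag_mat B = es"
    by auto
  have B: "B \<in> carrier_mat n n" using similar_mat_witD2[OF assms(1) sim] by simp
  have "mat_trace (A ^\<^sub>m k) = mat_trace (B ^\<^sub>m k)"
    by (rule mat_trace_similar[OF similar_mat_wit_pow[OF sim]])
  also have "\<dots> = (\<Sum>i<n. B $$ (i, i) ^ k)"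
    using upper_triangular_pow[OF B ut] B by (simp add: mat_trace_def)
  also have "\<dots> = (\<Sum>e\<leftarrow>es. e ^ k)"
    using B unfolding diag[symmetric]
    by (simp add: diag_mat_def interv_sum_list_conv_sum_set_nat atLeast0LessThan o_def)
  finally show ?thesis .
qed

text \<open>Orders add over linear factors, so the order of a root is its count in
  \<open>es\<close>. A list with repetitions is the form in which power sums arise from
  traces.\<close>

lemma matrix_energy_eq_sum_list:
  assumes "A \<in> carrier_mat n n" "char_poly A = (\<Prod>e\<leftarrow>es. [:- e, 1:])"
  shows "matrix_energy A = (\<Sum>e\<leftarrow>es. cmod e)"
proof -
  have roots: "{e. eigenvalue A e} = set es"
    unfolding eigenvalue_root_char_poly[OF assms(1)] assms(2)
    by (auto simp: poly_prod_list prod_list_zero_iff o_def)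
  have order: "Polynomial.order e (char_poly A) = count_list es e" for e
    unfolding assms(2)
  proof (induction es)
    case (Cons a es)
    have "(\<Prod>e\<leftarrow>es. [:- e, 1:]) \<noteq> 0" by (auto simp: prod_list_zero_iff)
    then have "[:- a, 1:] * (\<Prod>e\<leftarrow>es. [:- e, 1:]) \<noteq> 0" by (metis mult_eq_0_iff one_neq_zero pCons_eq_0_iff)
    moreover have "Polynomial.order e [:- a, 1:] = (if a = e then 1 else 0)"
      by (simp add: order_linear')
    ultimately show ?case using Cons by (simp add: order_mult del: mult_pCons_left)
  qed simp
  \<comment> \<open>The set of roots changes during the induction on \<open>es\<close>; the index
    set is therefore freed to any finite superset \<open>X\<close>.\<close>
  have "(\<Sum>e\<in>X. real (count_list es e) * cmod e) = (\<Sum>e\<leftarrow>es. cmod e)"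
    if "finite X" "set es \<subseteq> X" for X
    using that(2)
  proof (induction es)
    case (Cons a es)
    have "(\<Sum>e\<in>X. real (count_list (a # es) e) * cmod e)
        = (\<Sum>e\<in>X. (if e = a then cmod a else 0) + real (count_list es e) * cmod e)"
      by (intro sum.cong) (auto simp: algebra_simps)
    also have "\<dots> = (\<Sum>e\<leftarrow>a # es. cmod e)"
      using Cons that(1) by (simp add: sum.distrib)
    finally show ?case .
  qed simp
  then show ?thesis
    unfolding matrix_energy_def roots order by simp
qed

text \<open>For a new node \<open>a\<close>, the polynomial \<open>q\<close> vanishes at the old
  nodes but not at \<open>a\<close>, so a multiple of it corrects the value at \<open>a\<close>
  alone.\<close>

lemma polynomial_interpolation:
  fixes f :: "'a::field \<Rightarrow> 'a"
  assumes "finite S"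
  shows "\<exists>p. \<forall>e\<in>S. poly p e = f e"
  using assms
proof (induction S)
  case (insert a S)
  then obtain p where p: "\<forall>e\<in>S. poly p e = f e" by blast
  define q where "q = (\<Prod>e\<in>S. [:- e, 1:])"
  have "poly q a \<noteq> 0" "\<forall>e\<in>S. poly q e = 0"
    using insert by (auto simp: q_def poly_prod)
  then have "\<forall>e\<in>insert a S. poly (p + Polynomial.smult ((f a - poly p a) / poly q a) q) e = f e"
    using p by simp
  then show ?case by blast
qed simp

section \<open>Matrices given by kernels on the vertex set\<close>

text \<open>Kernels are functions of vertices rather than of indices: a tensor product is then a
  pointwise product of kernels over tuples, free of Kronecker index arithmetic, and the enumeration
  \<open>vs\<close> enters only here.\<close>

definition kernel_matrix :: "('v \<Rightarrow> 'v \<Rightarrow> 'a) \<Rightarrow> 'v list \<Rightarrow> 'a mat"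
  where "kernel_matrix K vs = mat (length vs) (length vs) (\<lambda>(i, j). K (vs ! i) (vs ! j))"

lemma kernel_matrix_mult:
  fixes K L :: "'v \<Rightarrow> 'v \<Rightarrow> 'a::comm_ring_1"
  assumes "distinct vs"
  shows "kernel_matrix K vs * kernel_matrix L vs
    = kernel_matrix (\<lambda>u v. \<Sum>w\<in>set vs. K u w * L w v) vs"
  by (rule eq_matI)
    (auto simp: kernel_matrix_def scalar_prod_def sum.distinct_set_conv_list[OF assms] sum_list_sum_nth)

lemma mat_trace_kernel_matrix:
  fixes K :: "'v \<Rightarrow> 'v \<Rightarrow> 'a::comm_ring_1"
  assumes "distinct vs"
  shows "mat_trace (kernel_matrix K vs) = (\<Sum>v\<in>set vs. K v v)"
  by (simp add: mat_trace_def kernel_matrix_def sum_list_sum_nth atLeast0LessThan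
    sum.distinct_set_conv_list[OF assms])

text \<open>The trace of \<^term>\<open>A ^\<^sub>m k\<close> is the \<^term>\<open>k\<close>-th power sum both of the eigenvalues of
  \<^term>\<open>A\<close> and of the numbers \<^term>\<open>\<mu> t\<close> weighted by the traces of the idempotents; replacing
  powers by a polynomial that interpolates the absolute value gives the energy.\<close>

lemma matrix_energy_idempotents:
  fixes K :: "'v \<Rightarrow> 'v \<Rightarrow> complex" and E :: "'t \<Rightarrow> 'v \<Rightarrow> 'v \<Rightarrow> complex"
  assumes "distinct vs" and "finite T"
    and K: "\<And>u v. u \<in> set vs \<Longrightarrow> v \<in> set vs \<Longrightarrow> K u v = (\<Sum>t\<in>T. \<mu> t * E t u v)"
    and one: "\<And>u v. u \<in> set vs \<Longrightarrow> v \<in> set vs \<Longrightarrow> (\<Sum>t\<in>T. E t u v) = (if u = v then 1 else 0)"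
    and orth: "\<And>s t u v. s \<in> T \<Longrightarrow> t \<in> T \<Longrightarrow> u \<in> set vs \<Longrightarrow> v \<in> set vs \<Longrightarrow>
      (\<Sum>w\<in>set vs. E s u w * E t w v) = (if s = t then E s u v else 0)"
  shows "complex_of_real (matrix_energy (kernel_matrix K vs))
    = (\<Sum>t\<in>T. of_real (cmod (\<mu> t)) * (\<Sum>v\<in>set vs. E t v v))"
proof -
  define n where "n = length vs"
  define A where "A = kernel_matrix K vs"
  have A: "A \<in> carrier_mat n n" by (simp add: A_def kernel_matrix_def n_def)
  obtain es where es: "char_poly A = (\<Prod>e\<leftarrow>es. [:- e, 1:])"
    using char_poly_factorized[OF A] by blast
  \<comment> \<open>Completeness \<open>one\<close> supplies the power 0, the identity matrix; in
    the induction step orthogonality collapses the double sum to its diagonal.\<close>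
  have pow: "A ^\<^sub>m k = kernel_matrix (\<lambda>u v. \<Sum>t\<in>T. \<mu> t ^ k * E t u v) vs" for k
  proof (induction k)
    case 0
    show ?case
      by (rule eq_matI) (use A in \<open>auto simp: kernel_matrix_def n_def one
        nth_eq_iff_index_eq[OF assms(1)]\<close>)
  next
    case (Suc k)
    have "(\<Sum>w\<in>set vs. (\<Sum>s\<in>T. \<mu> s ^ k * E s u w) * K w v) = (\<Sum>t\<in>T. \<mu> t ^ Suc k * E t u v)"
      if "u \<in> set vs" "v \<in> set vs" for u v
    proof -
      have "(\<Sum>w\<in>set vs. (\<Sum>s\<in>T. \<mu> s ^ k * E s u w) * K w v)
          = (\<Sum>w\<in>set vs. \<Sum>s\<in>T. \<Sum>t\<in>T. \<mu> s ^ k * \<mu> t * (E s u w * E t w v))"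
        using that by (intro sum.cong refl) (simp only: K sum_product, simp add: mult_ac)
      also have "\<dots> = (\<Sum>s\<in>T. \<Sum>t\<in>T. \<Sum>w\<in>set vs. \<mu> s ^ k * \<mu> t * (E s u w * E t w v))"
        by (subst sum.swap) (intro sum.cong refl, rule sum.swap)
      also have "\<dots> = (\<Sum>s\<in>T. \<Sum>t\<in>T. if s = t then \<mu> s ^ k * \<mu> t * E s u v else 0)"
        using that by (intro sum.cong refl) (simp add: orth flip: sum_distrib_left)
      also have "\<dots> = (\<Sum>s\<in>T. \<mu> s ^ Suc k * E s u v)"
        using \<open>finite T\<close> by (simp add: algebra_simps)
      finally show ?thesis .
    qed
    note step = this
    have "A ^\<^sub>m Suc k = kernel_matrix (\<lambda>u v. \<Sum>t\<in>T. \<mu> t ^ k * E t u v) vs * kernel_matrix K vs"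
      by (simp add: Suc) (simp add: A_def)
    also have "\<dots> = kernel_matrix (\<lambda>u v. \<Sum>t\<in>T. \<mu> t ^ Suc k * E t u v) vs"
      unfolding kernel_matrix_mult[OF assms(1)]
      by (unfold kernel_matrix_def, rule cong_mat) (simp_all only: prod.case nth_mem step)
    finally show ?case .
  qed
  have power_sum: "(\<Sum>e\<leftarrow>es. e ^ k) = (\<Sum>t\<in>T. \<mu> t ^ k * (\<Sum>v\<in>set vs. E t v v))" for k
  proof -
    have "(\<Sum>e\<leftarrow>es. e ^ k) = (\<Sum>v\<in>set vs. \<Sum>t\<in>T. \<mu> t ^ k * E t v v)"
      using mat_trace_pow[OF A es, of k] by (simp add: pow mat_trace_kernel_matrix[OF assms(1)])
    also have "\<dots> = (\<Sum>t\<in>T. \<mu> t ^ k * (\<Sum>v\<in>set vs. E t v v))"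
      by (subst sum.swap) (simp add: sum_distrib_left)
    finally show ?thesis .
  qed
  have poly_sum: "(\<Sum>e\<leftarrow>es. poly p e) = (\<Sum>t\<in>T. poly p (\<mu> t) * (\<Sum>v\<in>set vs. E t v v))" for p
  proof -
    have "(\<Sum>e\<leftarrow>es. poly p e) = (\<Sum>k\<le>degree p. coeff p k * (\<Sum>e\<leftarrow>es. e ^ k))"
      by (induction es) (simp_all add: poly_altdef sum.distrib algebra_simps)
    also have "\<dots> = (\<Sum>t\<in>T. \<Sum>k\<le>degree p. coeff p k * \<mu> t ^ k * (\<Sum>v\<in>set vs. E t v v))"
      unfolding power_sum sum_distrib_left by (subst sum.swap) (simp add: algebra_simps)
    also have "\<dots> = (\<Sum>t\<in>T. poly p (\<mu> t) * (\<Sum>v\<in>set vs. E t v v))"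
      by (simp add: poly_altdef sum_distrib_right)
    finally show ?thesis .
  qed
  \<comment> \<open>The nodes include both the roots and all \<open>\<mu> t\<close>. The two sets
    need not coincide, since an idempotent \<open>E t\<close> may be zero and \<open>\<mu> t\<close>
    then need not be an eigenvalue.\<close>
  obtain p where p: "\<forall>e\<in>set es \<union> \<mu> ` T. poly p e = of_real (cmod e)"
    using polynomial_interpolation[of "set es \<union> \<mu> ` T" "\<lambda>e. of_real (cmod e)"] \<open>finite T\<close> by auto
  have "complex_of_real (matrix_energy A) = (\<Sum>e\<leftarrow>es. of_real (cmod e))"
    unfolding matrix_energy_eq_sum_list[OF A es] by (induction es) auto
  also have "\<dots> = (\<Sum>e\<leftarrow>es. poly p e)"
    using p by (intro arg_cong[where f = sum_list] map_cong) auto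
  also have "\<dots> = (\<Sum>t\<in>T. of_real (cmod (\<mu> t)) * (\<Sum>v\<in>set vs. E t v v))"
    unfolding poly_sum using p by simp
  finally show ?thesis unfolding A_def .
qed

text \<open>By \<open>row\<close> and \<open>col\<close>, \<open>J / n\<close> is absorbed by
  \<open>E t0\<close> and annihilated by the other idempotents. So \<open>E t0\<close> splits into
  \<open>J / n\<close>, of trace 1, and \<open>E t0 - J / n\<close>. On \<open>J / n\<close> the
  complement has eigenvalue \<open>n - 1 - \<kappa> t0\<close>, elsewhere
  \<open>-1 - \<kappa> t\<close>; the subtracted term pays for the trace that \<open>E t0\<close>
  loses.\<close>

lemma matrix_energy_complement:
  fixes A :: "'v \<Rightarrow> 'v \<Rightarrow> complex" and E :: "'t \<Rightarrow> 'v \<Rightarrow> 'v \<Rightarrow> complex"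
  assumes "distinct vs" "vs \<noteq> []" "finite T" "t0 \<in> T"
    and A: "\<And>u v. u \<in> set vs \<Longrightarrow> v \<in> set vs \<Longrightarrow> A u v = (\<Sum>t\<in>T. \<kappa> t * E t u v)"
    and one: "\<And>u v. u \<in> set vs \<Longrightarrow> v \<in> set vs \<Longrightarrow> (\<Sum>t\<in>T. E t u v) = (if u = v then 1 else 0)"
    and orth: "\<And>s t u v. s \<in> T \<Longrightarrow> t \<in> T \<Longrightarrow> u \<in> set vs \<Longrightarrow> v \<in> set vs \<Longrightarrow>
      (\<Sum>w\<in>set vs. E s u w * E t w v) = (if s = t then E s u v else 0)"
    and row: "\<And>t u. t \<in> T \<Longrightarrow> u \<in> set vs \<Longrightarrow> (\<Sum>w\<in>set vs. E t u w) = (if t = t0 then 1 else 0)"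
    and col: "\<And>t v. t \<in> T \<Longrightarrow> v \<in> set vs \<Longrightarrow> (\<Sum>w\<in>set vs. E t w v) = (if t = t0 then 1 else 0)"
  shows "complex_of_real (matrix_energy (kernel_matrix (\<lambda>u v. (if u = v then 0 else 1) - A u v) vs))
    = of_real (cmod (of_nat (length vs) - 1 - \<kappa> t0)) - of_real (cmod (1 + \<kappa> t0))
      + (\<Sum>t\<in>T. of_real (cmod (1 + \<kappa> t)) * (\<Sum>v\<in>set vs. E t v v))"
proof -
  define n :: complex where "n = of_nat (length vs)"
  have n: "n \<noteq> 0" using assms(2) by (simp add: n_def)
  have card: "of_nat (card (set vs)) = n" using distinct_card[OF assms(1)] by (simp add: n_def)
  \<comment> \<open>\<open>c t\<close> is the constant entry removed from \<open>E t\<close>: that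
    of \<open>J / n\<close> for \<open>t0\<close>, and 0 otherwise. In the new family,
    \<open>None\<close> indexes \<open>J / n\<close> itself.\<close>
  define c where "c t = (if t = t0 then 1 / n else 0)" for t
  have sum_c: "(\<Sum>t\<in>T. f t * c t) = f t0 / n" for f
    using assms(3,4) by (simp add: c_def if_distrib[of "(*) _"] cong: if_cong)
  define F where "F = case_option (\<lambda>u v. 1 / n) (\<lambda>t u v. E t u v - c t)"
  define \<mu> where "\<mu> = case_option (n - 1 - \<kappa> t0) (\<lambda>t. - 1 - \<kappa> t)"
  have F: "F None = (\<lambda>u v. 1 / n)" "F (Some t) = (\<lambda>u v. E t u v - c t)" for t
    by (simp_all add: F_def)
  have \<mu>: "\<mu> None = n - 1 - \<kappa> t0" "\<mu> (Some t) = - 1 - \<kappa> t" for t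
    by (simp_all add: \<mu>_def)
  let ?T = "insert None (Some ` T)"
  have sum_T: "(\<Sum>t\<in>?T. f t) = f None + (\<Sum>t\<in>T. f (Some t))" for f :: "'t option \<Rightarrow> complex"
    using assms(3) by (simp add: sum.reindex)
  have "complex_of_real (matrix_energy (kernel_matrix (\<lambda>u v. (if u = v then 0 else 1) - A u v) vs))
      = (\<Sum>t\<in>?T. of_real (cmod (\<mu> t)) * (\<Sum>v\<in>set vs. F t v v))"
  proof (rule matrix_energy_idempotents[OF assms(1), where \<mu> = \<mu> and E = F])
    show "(if u = v then 0 else 1) - A u v = (\<Sum>t\<in>?T. \<mu> t * F t u v)"
      if uv: "u \<in> set vs" "v \<in> set vs" for u v
    proof -
      have "(\<Sum>t\<in>T. \<mu> (Some t) * F (Some t) u v)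
          = (\<Sum>t\<in>T. (1 + \<kappa> t) * c t) - (\<Sum>t\<in>T. E t u v) - (\<Sum>t\<in>T. \<kappa> t * E t u v)"
        by (simp add: F \<mu> algebra_simps sum.distrib sum_subtractf sum_negf)
      also have "\<dots> = (1 + \<kappa> t0) / n - (if u = v then 1 else 0) - A u v"
        using uv by (simp only: sum_c one A)
      finally have S: "(\<Sum>t\<in>T. \<mu> (Some t) * F (Some t) u v)
        = (1 + \<kappa> t0) / n - (if u = v then 1 else 0) - A u v" .
      show ?thesis
        using n unfolding sum_T S by (cases "u = v") (simp_all add: F \<mu> field_simps)
    qed
    show "(\<Sum>t\<in>?T. F t u v) = (if u = v then 1 else 0)"
      if uv: "u \<in> set vs" "v \<in> set vs" for u v
      unfolding sum_T using one[OF uv] sum_c[of "\<lambda>_. 1"] by (simp add: F sum_subtractf)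
    \<comment> \<open>For \<open>s = t = t0\<close> the three corrections add up to
      \<open>-1/n - 1/n + 1/n = -1/n\<close>, so the shifted kernel is again idempotent; in all
      other cases each of them vanishes.\<close>
    have expand: "(\<Sum>w\<in>set vs. (E s u w - c s) * (E t w v - c t))
        = (\<Sum>w\<in>set vs. E s u w * E t w v) - (\<Sum>w\<in>set vs. E s u w) * c t
          - c s * (\<Sum>w\<in>set vs. E t w v) + n * c s * c t" for s t u v
      by (simp add: algebra_simps sum.distrib sum_subtractf sum_distrib_left card)
    show "(\<Sum>w\<in>set vs. F s u w * F t w v) = (if s = t then F s u v else 0)"
      if "s \<in> ?T" "t \<in> ?T" and uv: "u \<in> set vs" "v \<in> set vs" for s t u v
    proof (cases s)
      case None
      show ?thesis
      proof (cases t)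
        case None
        with \<open>s = None\<close> show ?thesis using n by (simp add: F card)
      next
        case (Some t')
        then have "(\<Sum>w\<in>set vs. E t' w v - c t') = 0"
          using that col[of t' v] n by (auto simp: sum_subtractf card c_def)
        with None Some show ?thesis by (simp add: F flip: sum_divide_distrib)
      qed
    next
      case s': (Some s')
      show ?thesis
      proof (cases t)
        case None
        have "(\<Sum>w\<in>set vs. E s' u w - c s') = 0"
          using that s' row[of s' u] n by (auto simp: sum_subtractf card c_def)
        with None s' show ?thesis by (simp add: F flip: sum_divide_distrib)
      next
        case (Some t')
        then have T: "s' \<in> T" "t' \<in> T" using that s' by auto
        show ?thesis
          using n by (simp add: s' Some F expand orth[OF T uv] row[OF T(1) uv(1)] col[OF T(2) uv(2)])
            (auto simp: c_def)
      qed
    qed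
  qed (use assms(3) in simp)
  also have "\<dots> = of_real (cmod (n - 1 - \<kappa> t0)) +
      (\<Sum>t\<in>T. of_real (cmod (1 + \<kappa> t)) * (\<Sum>v\<in>set vs. E t v v - c t))"
  proof -
    have "cmod (- 1 - z) = cmod (1 + z)" for z
      using norm_minus_cancel[of "1 + z"] by (simp add: algebra_simps)
    then show ?thesis unfolding sum_T using n by (simp add: F \<mu> card)
  qed
  \<comment> \<open>The last sum keeps only \<open>t0\<close>, where the factor
    \<open>n * c t0\<close> is the trace 1 of \<open>J / n\<close>.\<close>
  also have "(\<Sum>t\<in>T. of_real (cmod (1 + \<kappa> t)) * (\<Sum>v\<in>set vs. E t v v - c t))
      = (\<Sum>t\<in>T. of_real (cmod (1 + \<kappa> t)) * (\<Sum>v\<in>set vs. E t v v))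
        - (\<Sum>t\<in>T. (of_real (cmod (1 + \<kappa> t)) * n) * c t)"
    by (simp add: sum_subtractf card algebra_simps)
  finally show ?thesis unfolding sum_c using n by (simp add: n_def)
qed

section \<open>Tensor products of families of idempotents\<close>

lemma prod_if_zero:
  assumes "finite I"
  shows "(\<Prod>i\<in>I. if Q i then f i else (0::'a::comm_semiring_1)) = (if \<forall>i\<in>I. Q i then \<Prod>i\<in>I. f i else 0)"
  using assms by (induction I) auto

text \<open>Integrality is essential: for real \<open>l\<close> strictly between -1 and 0 the
  right-hand side is \<open>|l| - 1\<close>, which is negative. Every summand on the right is
  multiplicative in \<open>l\<close>.\<close>

lemma abs_one_plus_int: "\<bar>1 + l\<bar> = 1 + \<bar>l\<bar> + sgn l - \<bar>sgn l\<bar>" for l :: int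
  by (auto simp: sgn_if)

text \<open>Expanding the product of the factor decompositions gives one idempotent for each choice
  function \<open>t\<close>, with eigenvalue and trace both products over \<open>I\<close>. The
  summand \<open>n\<close> is the piece coming from the constant 1, and the last three lines are the
  other pieces.\<close>

lemma matrix_energy_product_complement:
  fixes V :: "'i \<Rightarrow> 'v set" and a :: "'i \<Rightarrow> 'v \<Rightarrow> 'v \<Rightarrow> complex"
    and E :: "'i \<Rightarrow> 'c \<Rightarrow> 'v \<Rightarrow> 'v \<Rightarrow> complex"
    and \<kappa> :: "'i \<Rightarrow> 'c \<Rightarrow> int" and d :: "'i \<Rightarrow> 'c \<Rightarrow> real"
  assumes "finite I" "finite C" "c0 \<in> C" "distinct vs" "set vs = PiE I V"
    and V: "\<And>i. i \<in> I \<Longrightarrow> finite (V i)" "\<And>i. i \<in> I \<Longrightarrow> V i \<noteq> {}"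
    and a: "\<And>i u v. i \<in> I \<Longrightarrow> u \<in> V i \<Longrightarrow> v \<in> V i \<Longrightarrow> a i u v = (\<Sum>c\<in>C. of_int (\<kappa> i c) * E i c u v)"
    and one: "\<And>i u v. i \<in> I \<Longrightarrow> u \<in> V i \<Longrightarrow> v \<in> V i \<Longrightarrow>
      (\<Sum>c\<in>C. E i c u v) = (if u = v then 1 else 0)"
    and orth: "\<And>i s c u v. i \<in> I \<Longrightarrow> s \<in> C \<Longrightarrow> c \<in> C \<Longrightarrow> u \<in> V i \<Longrightarrow> v \<in> V i \<Longrightarrow>
      (\<Sum>w\<in>V i. E i s u w * E i c w v) = (if s = c then E i s u v else 0)"
    and row: "\<And>i c u. i \<in> I \<Longrightarrow> c \<in> C \<Longrightarrow> u \<in> V i \<Longrightarrow> (\<Sum>w\<in>V i. E i c u w) = (if c = c0 then 1 else 0)"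
    and col: "\<And>i c v. i \<in> I \<Longrightarrow> c \<in> C \<Longrightarrow> v \<in> V i \<Longrightarrow> (\<Sum>w\<in>V i. E i c w v) = (if c = c0 then 1 else 0)"
    and d: "\<And>i c. i \<in> I \<Longrightarrow> c \<in> C \<Longrightarrow> (\<Sum>v\<in>V i. E i c v v) = of_real (d i c)"
  defines "n \<equiv> \<Prod>i\<in>I. real (card (V i))" and "k \<equiv> real_of_int (\<Prod>i\<in>I. \<kappa> i c0)"
  shows "matrix_energy (kernel_matrix (\<lambda>u v. (if u = v then 0 else 1) - (\<Prod>i\<in>I. a i (u i) (v i))) vs)
    = \<bar>n - 1 - k\<bar> - \<bar>1 + k\<bar> + n
      + (\<Prod>i\<in>I. \<Sum>c\<in>C. of_int \<bar>\<kappa> i c\<bar> * d i c)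
      + (\<Prod>i\<in>I. \<Sum>c\<in>C. of_int (sgn (\<kappa> i c)) * d i c)
      - (\<Prod>i\<in>I. \<Sum>c\<in>C. of_int \<bar>sgn (\<kappa> i c)\<bar> * d i c)"
proof -
  let ?T = "PiE I (\<lambda>_. C)"
  \<comment> \<open>Row sums factor over \<open>I\<close>, so the only choice with a nonzero row sum
    is the one taking \<open>c0\<close> everywhere.\<close>
  define t0 where "t0 = (\<lambda>i\<in>I. c0)"
  define L where "L t = (\<Prod>i\<in>I. \<kappa> i (t i))" for t
  define F where "F t u v = (\<Prod>i\<in>I. E i (t i) (u i) (v i))" for t u v
  have t0: "t0 \<in> ?T" using assms(3) by (auto simp: t0_def)
  have eq_t0: "(\<forall>i\<in>I. t i = c0) \<longleftrightarrow> t = t0" if "t \<in> ?T" for t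
    using that t0 PiE_ext[of t I "\<lambda>_. C" t0] by (auto simp: t0_def)
  have L0: "L t0 = (\<Prod>i\<in>I. \<kappa> i c0)" by (simp add: L_def t0_def)
  have len: "real (length vs) = n"
    using distinct_card[OF assms(4)] card_PiE[OF assms(1), of V] by (simp add: assms(5) n_def flip: of_nat_prod)
  have "vs \<noteq> []"
  proof
    assume "vs = []"
    then have "PiE I V = {}" using assms(5) by simp
    then show False using V(2) by (auto simp: PiE_eq_empty_iff)
  qed
  have trace: "(\<Sum>v\<in>PiE I V. F t v v) = of_real (\<Prod>i\<in>I. d i (t i))" if "t \<in> ?T" for t
  proof -
    have "(\<Sum>v\<in>PiE I V. F t v v) = (\<Prod>i\<in>I. \<Sum>v\<in>V i. E i (t i) v v)"
      unfolding F_def using assms(1) V by (intro prod_sum_PiE[symmetric]) auto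
    also have "\<dots> = of_real (\<Prod>i\<in>I. d i (t i))"
      unfolding of_real_prod using that by (intro prod.cong refl d) auto
    finally show ?thesis .
  qed
  have "complex_of_real (matrix_energy
      (kernel_matrix (\<lambda>u v. (if u = v then 0 else 1) - (\<Prod>i\<in>I. a i (u i) (v i))) vs))
    = of_real (cmod (of_nat (length vs) - 1 - of_int (L t0))) - of_real (cmod (1 + of_int (L t0)))
      + (\<Sum>t\<in>?T. of_real (cmod (1 + of_int (L t))) * (\<Sum>v\<in>set vs. F t v v))"
  proof (rule matrix_energy_complement[OF assms(4) \<open>vs \<noteq> []\<close> _ t0,
      where \<kappa> = "\<lambda>t. of_int (L t)" and E = F], unfold assms(5))
    show "finite ?T" using assms(1,2) by (auto intro: finite_PiE)
    show "(\<Prod>i\<in>I. a i (u i) (v i)) = (\<Sum>t\<in>?T. of_int (L t) * F t u v)"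
      if "u \<in> PiE I V" "v \<in> PiE I V" for u v
    proof -
      have "(\<Prod>i\<in>I. a i (u i) (v i)) = (\<Prod>i\<in>I. \<Sum>c\<in>C. of_int (\<kappa> i c) * E i c (u i) (v i))"
        using that by (intro prod.cong refl a) auto
      also have "\<dots> = (\<Sum>t\<in>?T. \<Prod>i\<in>I. of_int (\<kappa> i (t i)) * E i (t i) (u i) (v i))"
        by (rule prod_sum_PiE[OF assms(1,2)])
      finally show ?thesis by (simp add: L_def F_def prod.distrib)
    qed
    show "(\<Sum>t\<in>?T. F t u v) = (if u = v then 1 else 0)"
      if "u \<in> PiE I V" "v \<in> PiE I V" for u v
    proof -
      have "(\<Sum>t\<in>?T. F t u v) = (\<Prod>i\<in>I. \<Sum>c\<in>C. E i c (u i) (v i))"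
        unfolding F_def by (rule prod_sum_PiE[OF assms(1,2), symmetric])
      also have "\<dots> = (\<Prod>i\<in>I. if u i = v i then 1 else 0)"
        using that by (intro prod.cong refl one) auto
      also have "\<dots> = (if u = v then 1 else 0)"
        using that PiE_ext[of u I V v] by (auto simp: prod_if_zero[OF assms(1)])
      finally show ?thesis .
    qed
    show "(\<Sum>w\<in>PiE I V. F s u w * F t w v) = (if s = t then F s u v else 0)"
      if "s \<in> ?T" "t \<in> ?T" "u \<in> PiE I V" "v \<in> PiE I V" for s t u v
    proof -
      have "(\<Sum>w\<in>PiE I V. F s u w * F t w v)
          = (\<Prod>i\<in>I. \<Sum>w\<in>V i. E i (s i) (u i) w * E i (t i) w (v i))"
        unfolding F_def prod.distrib[symmetric]
        using assms(1) V by (intro prod_sum_PiE[symmetric]) auto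
      also have "\<dots> = (\<Prod>i\<in>I. if s i = t i then E i (s i) (u i) (v i) else 0)"
        using that by (intro prod.cong refl orth) auto
      also have "\<dots> = (if s = t then F s u v else 0)"
        using that PiE_ext[of s I "\<lambda>_. C" t] by (auto simp: prod_if_zero[OF assms(1)] F_def)
      finally show ?thesis .
    qed
    show "(\<Sum>w\<in>PiE I V. F t u w) = (if t = t0 then 1 else 0)"
      if "t \<in> ?T" "u \<in> PiE I V" for t u
    proof -
      have "(\<Sum>w\<in>PiE I V. F t u w) = (\<Prod>i\<in>I. \<Sum>w\<in>V i. E i (t i) (u i) w)"
        unfolding F_def using assms(1) V by (intro prod_sum_PiE[symmetric]) auto
      also have "\<dots> = (\<Prod>i\<in>I. if t i = c0 then 1 else 0)"
        using that by (intro prod.cong refl row) auto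
      finally show ?thesis using that by (simp add: prod_if_zero[OF assms(1)] eq_t0)
    qed
    show "(\<Sum>w\<in>PiE I V. F t w v) = (if t = t0 then 1 else 0)"
      if "t \<in> ?T" "v \<in> PiE I V" for t v
    proof -
      have "(\<Sum>w\<in>PiE I V. F t w v) = (\<Prod>i\<in>I. \<Sum>w\<in>V i. E i (t i) w (v i))"
        unfolding F_def using assms(1) V by (intro prod_sum_PiE[symmetric]) auto
      also have "\<dots> = (\<Prod>i\<in>I. if t i = c0 then 1 else 0)"
        using that by (intro prod.cong refl col) auto
      finally show ?thesis using that by (simp add: prod_if_zero[OF assms(1)] eq_t0)
    qed
  qed
  also have "\<dots> = of_real (\<bar>n - 1 - k\<bar> - \<bar>1 + k\<bar> + (\<Sum>t\<in>?T. \<bar>1 + of_int (L t)\<bar> * (\<Prod>i\<in>I. d i (t i))))"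
  proof -
    have *: "cmod (1 + of_int z) = \<bar>1 + of_int z\<bar>" for z
      by (metis norm_of_real of_real_1 of_real_add of_real_of_int_eq)
    have "complex_of_nat (length vs) - 1 - of_int (L t0) = of_real (n - 1 - k)"
      by (simp add: L0 k_def flip: len)
    then have "cmod (of_nat (length vs) - 1 - of_int (L t0)) = \<bar>n - 1 - k\<bar>"
      by (metis norm_of_real)
    moreover have "k = of_int (L t0)" by (simp add: L0 k_def)
    ultimately show ?thesis
      by (simp add: * assms(5) trace)
  qed
  finally have energy: "matrix_energy
      (kernel_matrix (\<lambda>u v. (if u = v then 0 else 1) - (\<Prod>i\<in>I. a i (u i) (v i))) vs)
      = \<bar>n - 1 - k\<bar> - \<bar>1 + k\<bar> + (\<Sum>t\<in>?T. \<bar>1 + of_int (L t)\<bar> * (\<Prod>i\<in>I. d i (t i)))"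
    unfolding of_real_eq_iff .
  \<comment> \<open>Distributivity read backwards: summands that are products over \<open>I\<close>
    turn the sum over all choices into a product of sums. It is applied with \<open>f\<close> equal
    to 1, \<open>|\<kappa>|\<close>, \<open>sgn \<kappa>\<close> and
    \<open>|sgn \<kappa>|\<close>.\<close>
  have mult: "(\<Sum>t\<in>?T. of_int (\<Prod>i\<in>I. f i (t i)) * (\<Prod>i\<in>I. d i (t i))) = (\<Prod>i\<in>I. \<Sum>c\<in>C. of_int (f i c) * d i c)"
    for f :: "'i \<Rightarrow> 'c \<Rightarrow> int"
    unfolding prod_sum_PiE[OF assms(1,2)] by (simp add: prod.distrib)
  \<comment> \<open>The idempotents of a factor add up to the identity, whose trace is the number of
    vertices.\<close>
  have "(\<Sum>c\<in>C. d i c) = card (V i)" if "i \<in> I" for i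
  proof -
    have "complex_of_real (\<Sum>c\<in>C. d i c) = (\<Sum>c\<in>C. \<Sum>v\<in>V i. E i c v v)"
      using that by (simp add: d)
    also have "\<dots> = (\<Sum>v\<in>V i. \<Sum>c\<in>C. E i c v v)"
      by (rule sum.swap)
    also have "\<dots> = of_real (card (V i))"
      using that by (simp add: one)
    finally show ?thesis by (simp only: of_real_eq_iff)
  qed
  then have n: "(\<Prod>i\<in>I. \<Sum>c\<in>C. of_int 1 * d i c) = n"
    by (simp add: n_def)
  have "\<bar>1 + of_int (L t)\<bar> = of_int (\<Prod>i\<in>I. 1) + of_int (\<Prod>i\<in>I. \<bar>\<kappa> i (t i)\<bar>)
      + of_int (\<Prod>i\<in>I. sgn (\<kappa> i (t i))) - (of_int (\<Prod>i\<in>I. \<bar>sgn (\<kappa> i (t i))\<bar>) :: real)" for t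
  proof -
    have sgn: "(\<Prod>i\<in>I. sgn (\<kappa> i (t i))) = sgn (L t)"
      unfolding L_def using assms(1) by (induction I) (auto simp: sgn_mult)
    have "\<bar>1 + of_int (L t)\<bar> = (of_int \<bar>1 + L t\<bar> :: real)" by simp
    also have "\<dots> = of_int (1 + \<bar>L t\<bar> + sgn (L t) - \<bar>sgn (L t)\<bar>)"
      unfolding abs_one_plus_int ..
    finally show ?thesis
      unfolding sgn[symmetric] unfolding L_def abs_prod by simp
  qed
  then have "(\<Sum>t\<in>?T. \<bar>1 + of_int (L t)\<bar> * (\<Prod>i\<in>I. d i (t i)))
    = (\<Sum>t\<in>?T. of_int (\<Prod>i\<in>I. 1) * (\<Prod>i\<in>I. d i (t i)))
      + (\<Sum>t\<in>?T. of_int (\<Prod>i\<in>I. \<bar>\<kappa> i (t i)\<bar>) * (\<Prod>i\<in>I. d i (t i)))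
      + (\<Sum>t\<in>?T. of_int (\<Prod>i\<in>I. sgn (\<kappa> i (t i))) * (\<Prod>i\<in>I. d i (t i)))
      - (\<Sum>t\<in>?T. of_int (\<Prod>i\<in>I. \<bar>sgn (\<kappa> i (t i))\<bar>) * (\<Prod>i\<in>I. d i (t i)))"
    by (simp only: distrib_right left_diff_distrib sum.distrib sum_subtractf)
  then show ?thesis
    unfolding energy mult[of "\<lambda>i c. 1"] mult[of "\<lambda>i c. \<bar>\<kappa> i c\<bar>"] mult[of "\<lambda>i c. sgn (\<kappa> i c)"]
      mult[of "\<lambda>i c. \<bar>sgn (\<kappa> i c)\<bar>"] n
    by (simp only: add.assoc add_diff_eq)
qed

section \<open>Additive subgroups and local factors\<close>

definition subgroup_kernel :: "('a, 'm) ring_scheme \<Rightarrow> 'a set \<Rightarrow> 'a \<Rightarrow> 'a \<Rightarrow> complex"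
  where "subgroup_kernel R H u v = (if u \<ominus>\<^bsub>R\<^esub> v \<in> H then 1 / of_nat (card H) else 0)"

context ring
begin

lemma card_translates:
  assumes "H \<subseteq> carrier R" "u \<in> carrier R"
  shows "card {w \<in> carrier R. u \<ominus> w \<in> H} = card H"
    and "card {w \<in> carrier R. w \<ominus> u \<in> H} = card H"
proof -
  have cancel: "u \<ominus> (u \<ominus> w) = w" "(w \<ominus> u) \<oplus> u = w" "(w \<oplus> u) \<ominus> u = w" if "w \<in> carrier R" for w
  proof -
    show "u \<ominus> (u \<ominus> w) = w" "(w \<ominus> u) \<oplus> u = w"
      using assms(2) that by algebra+
    show "(w \<oplus> u) \<ominus> u = w"
      using assms(2) that by algebra
  qed
  have "bij_betw (\<lambda>w. u \<ominus> w) {w \<in> carrier R. u \<ominus> w \<in> H} H"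
    by (rule bij_betw_byWitness[where f' = "\<lambda>w. u \<ominus> w"]) (use assms cancel(1) in auto)
  then show "card {w \<in> carrier R. u \<ominus> w \<in> H} = card H" by (rule bij_betw_same_card)
  have "bij_betw (\<lambda>w. w \<ominus> u) {w \<in> carrier R. w \<ominus> u \<in> H} H"
    by (rule bij_betw_byWitness[where f' = "\<lambda>w. w \<oplus> u"]) (use assms cancel(2,3) in auto)
  then show "card {w \<in> carrier R. w \<ominus> u \<in> H} = card H" by (rule bij_betw_same_card)
qed

lemma diff_mem_cong:
  assumes "additive_subgroup H R" "u \<ominus> w \<in> H" "u \<in> carrier R" "v \<in> carrier R" "w \<in> carrier R"
  shows "u \<ominus> v \<in> H \<longleftrightarrow> w \<ominus> v \<in> H" and "v \<ominus> u \<in> H \<longleftrightarrow> v \<ominus> w \<in> H"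
proof -
  interpret additive_subgroup H R by fact
  have eq: "u \<ominus> v = (u \<ominus> w) \<oplus> (w \<ominus> v)" "w \<ominus> v = \<ominus> (u \<ominus> w) \<oplus> (u \<ominus> v)"
    "v \<ominus> u = (v \<ominus> w) \<oplus> \<ominus> (u \<ominus> w)" "v \<ominus> w = (v \<ominus> u) \<oplus> (u \<ominus> w)"
    using assms(3-5) by algebra+
  show "u \<ominus> v \<in> H \<longleftrightarrow> w \<ominus> v \<in> H"
    using assms(2) eq(1,2) a_closed a_inv_closed by metis
  show "v \<ominus> u \<in> H \<longleftrightarrow> v \<ominus> w \<in> H"
    using assms(2) eq(3,4) a_closed a_inv_closed by metis
qed

context
  assumes fin: "finite (carrier R)"
begin

lemma card_additive_subgroup_pos:
  assumes "additive_subgroup H R"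
  shows "card H > 0"
  using additive_subgroup.zero_closed[OF assms] additive_subgroup.a_subset[OF assms] fin
  by (auto simp: card_gt_0_iff intro: finite_subset)

lemma sum_subgroup_kernel:
  assumes "additive_subgroup H R" "u \<in> carrier R"
  shows "(\<Sum>w\<in>carrier R. subgroup_kernel R H u w) = 1"
    and "(\<Sum>w\<in>carrier R. subgroup_kernel R H w u) = 1"
proof -
  note H = additive_subgroup.a_subset[OF assms(1)]
  have "{w \<in> carrier R. u \<ominus> w \<in> H} = carrier R \<inter> {w. u \<ominus> w \<in> H}"
    "{w \<in> carrier R. w \<ominus> u \<in> H} = carrier R \<inter> {w. w \<ominus> u \<in> H}" by auto
  with card_translates[OF H assms(2)] card_additive_subgroup_pos[OF assms(1)]
  show "(\<Sum>w\<in>carrier R. subgroup_kernel R H u w) = 1"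
    "(\<Sum>w\<in>carrier R. subgroup_kernel R H w u) = 1"
    using fin by (simp_all add: subgroup_kernel_def sum.If_cases)
qed

lemma trace_subgroup_kernel:
  assumes "additive_subgroup H R"
  shows "(\<Sum>v\<in>carrier R. subgroup_kernel R H v v) = of_real (real (card (carrier R)) / real (card H))"
  using additive_subgroup.zero_closed[OF assms] by (simp add: subgroup_kernel_def minus_eq r_neg)

text \<open>Where the \<open>K\<close>-kernel is nonzero, its two arguments share a coset of
  \<open>K\<close> and hence of \<open>H\<close>. The \<open>H\<close>-kernel is thus constant there
  and can be pulled out, leaving a row or column sum of the \<open>K\<close>-kernel, which is
  1.\<close>

lemma sum_subgroup_kernel_mult:
  assumes "additive_subgroup H R" "additive_subgroup K R" "K \<subseteq> H" "u \<in> carrier R" "v \<in> carrier R"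
  shows "(\<Sum>w\<in>carrier R. subgroup_kernel R H u w * subgroup_kernel R K w v) = subgroup_kernel R H u v"
    and "(\<Sum>w\<in>carrier R. subgroup_kernel R K u w * subgroup_kernel R H w v) = subgroup_kernel R H u v"
proof -
  have "subgroup_kernel R H u w * subgroup_kernel R K w v
      = subgroup_kernel R H u v * subgroup_kernel R K w v" if "w \<in> carrier R" for w
    using diff_mem_cong(2)[OF assms(1), of w v u] that assms by (auto simp: subgroup_kernel_def)
  then have "(\<Sum>w\<in>carrier R. subgroup_kernel R H u w * subgroup_kernel R K w v)
      = (\<Sum>w\<in>carrier R. subgroup_kernel R H u v * subgroup_kernel R K w v)"
    by (intro sum.cong refl)
  then show "(\<Sum>w\<in>carrier R. subgroup_kernel R H u w * subgroup_kernel R K w v) = subgroup_kernel R H u v"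
    by (simp add: sum_subgroup_kernel[OF assms(2,5)] flip: sum_distrib_left)
  have "subgroup_kernel R K u w * subgroup_kernel R H w v
      = subgroup_kernel R K u w * subgroup_kernel R H u v" if "w \<in> carrier R" for w
    using diff_mem_cong(1)[OF assms(1), of u w v] that assms by (auto simp: subgroup_kernel_def)
  then have "(\<Sum>w\<in>carrier R. subgroup_kernel R K u w * subgroup_kernel R H w v)
      = (\<Sum>w\<in>carrier R. subgroup_kernel R K u w * subgroup_kernel R H u v)"
    by (intro sum.cong refl)
  then show "(\<Sum>w\<in>carrier R. subgroup_kernel R K u w * subgroup_kernel R H w v) = subgroup_kernel R H u v"
    by (simp add: sum_subgroup_kernel[OF assms(2,4)] flip: sum_distrib_right)
qed

end

end

section \<open>The three idempotents of a chain of subgroups\<close>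

text \<open>Successive differences of coset averages along \<open>{0}\<close>, \<open>K\<close>,
  \<open>H\<close>. They project onto functions constant on \<open>H\<close>-cosets, functions
  constant on \<open>K\<close>-cosets with mean zero on \<open>H\<close>-cosets, and functions with
  mean zero on \<open>K\<close>-cosets.\<close>

definition chain_idempotent :: "('a, 'm) ring_scheme \<Rightarrow> 'a set \<Rightarrow> 'a set \<Rightarrow> nat \<Rightarrow> 'a \<Rightarrow> 'a \<Rightarrow> complex"
  where "chain_idempotent R H K c u v =
    (if c = 0 then subgroup_kernel R H u v
     else if c = 1 then subgroup_kernel R K u v - subgroup_kernel R H u v
     else subgroup_kernel R {\<zero>\<^bsub>R\<^esub>} u v - subgroup_kernel R K u v)"

lemma sum_lessThan_3: "(\<Sum>c<3. f c) = f 0 + f 1 + f (2::nat)"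
  by (simp add: numeral_eq_Suc)

text \<open>The sum telescopes to the kernel of \<open>{0}\<close>, which is the identity.
  Orthogonality expands into products of nested averages, and every average has row and column sums
  1, so the differences have 0.\<close>

lemma (in ring) chain_idempotents:
  assumes "finite (carrier R)" "additive_subgroup H R" "additive_subgroup K R" "K \<subseteq> H"
  shows sum_chain_idempotent: "u \<in> carrier R \<Longrightarrow> v \<in> carrier R \<Longrightarrow>
      (\<Sum>c<3. chain_idempotent R H K c u v) = (if u = v then 1 else 0)"
    and chain_idempotent_orthogonal: "s < 3 \<Longrightarrow> c < 3 \<Longrightarrow> u \<in> carrier R \<Longrightarrow> v \<in> carrier R \<Longrightarrow>
      (\<Sum>w\<in>carrier R. chain_idempotent R H K s u w * chain_idempotent R H K c w v)
        = (if s = c then chain_idempotent R H K s u v else 0)"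
    and chain_idempotent_row: "u \<in> carrier R \<Longrightarrow>
      (\<Sum>w\<in>carrier R. chain_idempotent R H K c u w) = (if c = 0 then 1 else 0)"
    and chain_idempotent_col: "v \<in> carrier R \<Longrightarrow>
      (\<Sum>w\<in>carrier R. chain_idempotent R H K c w v) = (if c = 0 then 1 else 0)"
    and chain_idempotent_trace: "(\<Sum>v\<in>carrier R. chain_idempotent R H K c v v)
        = of_real (if c = 0 then real (card (carrier R)) / real (card H)
          else if c = 1 then real (card (carrier R)) / real (card K) - real (card (carrier R)) / real (card H)
          else real (card (carrier R)) - real (card (carrier R)) / real (card K))"
proof -
  have Z: "additive_subgroup {\<zero>} R"
    by (intro additive_subgroupI add.triv_subgroup[simplified])
  have sub: "{\<zero>} \<subseteq> H" "{\<zero>} \<subseteq> K"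
    using additive_subgroup.zero_closed[OF assms(2)] additive_subgroup.zero_closed[OF assms(3)] by auto
  note mult = sum_subgroup_kernel_mult[OF assms(1)]
  note mult = mult(1)[OF assms(2,2) subset_refl] mult(1)[OF assms(3,3) subset_refl] mult(1)[OF Z Z subset_refl]
    mult[OF assms(2,3,4)] mult[OF assms(2) Z sub(1)] mult[OF assms(3) Z sub(2)]
  note single = sum_subgroup_kernel[OF assms(1,2)] sum_subgroup_kernel[OF assms(1,3)]
    sum_subgroup_kernel[OF assms(1) Z]
  note trace = trace_subgroup_kernel[OF assms(1,2)] trace_subgroup_kernel[OF assms(1,3)]
    trace_subgroup_kernel[OF assms(1) Z]
  show "(\<Sum>c<3. chain_idempotent R H K c u v) = (if u = v then 1 else 0)"
    if "u \<in> carrier R" "v \<in> carrier R"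
  proof -
    have "(u \<ominus> v) \<oplus> v = u" "v \<ominus> v = \<zero>" using that by algebra+
    then have "u \<ominus> v = \<zero> \<longleftrightarrow> u = v" using that by auto
    then show ?thesis
      unfolding sum_lessThan_3 by (simp add: chain_idempotent_def subgroup_kernel_def)
  qed
  show "(\<Sum>w\<in>carrier R. chain_idempotent R H K s u w * chain_idempotent R H K c w v)
      = (if s = c then chain_idempotent R H K s u v else 0)"
    if "s < 3" "c < 3" "u \<in> carrier R" "v \<in> carrier R"
  proof -
    have "s = 0 \<or> s = 1 \<or> s = 2" "c = 0 \<or> c = 1 \<or> c = 2" using that by auto
    then show ?thesis
      using that(3,4) by (elim disjE) (simp_all add: chain_idempotent_def left_diff_distrib
        right_diff_distrib sum_subtractf mult)
  qed
  show "(\<Sum>w\<in>carrier R. chain_idempotent R H K c u w) = (if c = 0 then 1 else 0)"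
    if "u \<in> carrier R"
    using that
    by (cases "c = 0"; cases "c = 1") (simp_all add: chain_idempotent_def sum_subtractf single)
  show "(\<Sum>w\<in>carrier R. chain_idempotent R H K c w v) = (if c = 0 then 1 else 0)"
    if "v \<in> carrier R"
    using that
    by (cases "c = 0"; cases "c = 1") (simp_all add: chain_idempotent_def sum_subtractf single)
  show "(\<Sum>v\<in>carrier R. chain_idempotent R H K c v v)
      = of_real (if c = 0 then real (card (carrier R)) / real (card H)
          else if c = 1 then real (card (carrier R)) / real (card K) - real (card (carrier R)) / real (card H)
          else real (card (carrier R)) - real (card (carrier R)) / real (card K))"
    by (cases "c = 0"; cases "c = 1") (simp_all add: chain_idempotent_def sum_subtractf trace)
qed

lemma (in cring) genideal_singleton_eq_image: "x \<in> carrier R \<Longrightarrow> Idl {x} = (\<lambda>r. x \<otimes> r) ` carrier R"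
  by (auto simp: cgenideal_eq_genideal[symmetric] cgenideal_def m_comm)

lemma unit_multiples_zero:
  assumes "ring R"
  shows "unit_multiples R \<zero>\<^bsub>R\<^esub> = {\<zero>\<^bsub>R\<^esub>}"
proof -
  interpret ring R by fact
  show ?thesis by (auto simp: unit_multiples_def Units_closed intro!: exI[of _ "\<one>\<^bsub>R\<^esub>"])
qed

section \<open>Nonunits and nongenerators in a finite local ring\<close>

context local_ring
begin

text \<open>The nonunits are exactly the unique maximal ideal: a nonunit generates a proper ideal,
  which lies in some maximal ideal, and a proper ideal contains no unit.\<close>

lemma nonunits_ideal:
  assumes "finite (carrier R)"
  shows "ideal (carrier R - Units R) R"
proof -
  obtain M where M: "maximalideal M R" and uniq: "\<And>N. maximalideal N R \<Longrightarrow> N = M"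
    using unique_maximal_ideal by blast
  interpret M: maximalideal M R by fact
  have "a \<in> M" if a: "a \<in> carrier R" "a \<notin> Units R" for a
  proof -
    define J where "J = {J. ideal J R \<and> a \<in> J \<and> J \<noteq> carrier R}"
    have "PIdl a \<in> J"
    proof -
      have "PIdl a \<noteq> carrier R"
      proof
        assume "PIdl a = carrier R"
        then obtain r where "r \<in> carrier R" "\<one> = r \<otimes> a" by (auto simp: cgenideal_def)
        then have "a \<in> Units R" using a(1) by (auto simp: Units_def m_comm intro!: bexI[of _ r])
        with a(2) show False by simp
      qed
      then show ?thesis
        using cgenideal_ideal[OF a(1)] cgenideal_self[OF a(1)] by (simp add: J_def)
    qed
    moreover have "finite J"
      by (rule finite_subset[of _ "Pow (carrier R)"])
        (use assms in \<open>auto simp: J_def dest: ideal.Icarr\<close>)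
    \<comment> \<open>Finiteness takes the place of Zorn's lemma: the proper ideals containing
      \<open>a\<close> are finitely many, so one of them is maximal.\<close>
    ultimately obtain N where N: "N \<in> J" "\<And>L. L \<in> J \<Longrightarrow> N \<subseteq> L \<Longrightarrow> L = N"
      using finite_has_maximal2 by metis
    have "maximalideal N R"
      by (rule maximalidealI) (use N in \<open>auto simp: J_def\<close>)
    then show ?thesis using uniq N(1) by (auto simp: J_def)
  qed
  moreover have "a \<notin> Units R" if "a \<in> M" for a
  proof
    assume "a \<in> Units R"
    then have "\<one> \<in> M" using M.I_r_closed[OF that, of "inv a"] by simp
    then show False using M.one_imp_carrier M.I_notcarr by simp
  qed
  ultimately have "carrier R - Units R = M" using M.Icarr by blast
  then show ?thesis by (simp add: M.is_ideal)
qed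

context
  fixes x
  assumes fin: "finite (carrier R)" and x: "x \<in> carrier R" "x \<noteq> \<zero>"
begin

text \<open>If \<open>x r = x u\<close> with \<open>r\<close> a nonunit and \<open>u\<close> a unit, then \<open>u - r\<close> is a unit annihilating \<open>x\<close>.\<close>

lemma nongenerators_eq_image: "nongenerators R x = (\<lambda>r. x \<otimes> r) ` (carrier R - Units R)"
proof -
  interpret M: ideal "carrier R - Units R" R by (rule nonunits_ideal[OF fin])
  have "x \<otimes> r \<noteq> x \<otimes> u" if r: "r \<in> carrier R - Units R" and u: "u \<in> Units R" for r u
  proof
    assume eq: "x \<otimes> r = x \<otimes> u"
    have carr: "r \<in> carrier R" "u \<in> carrier R" using r u by auto
    \<comment> \<open>Otherwise \<open>u\<close> would be a sum of two nonunits.\<close>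
    have "u \<ominus> r \<in> Units R"
    proof (rule ccontr)
      assume "u \<ominus> r \<notin> Units R"
      then have "(u \<ominus> r) \<oplus> r \<in> carrier R - Units R"
        using carr r by (intro M.a_closed) auto
      moreover have "(u \<ominus> r) \<oplus> r = u" using carr by algebra
      ultimately show False using u by simp
    qed
    moreover have "x \<otimes> (u \<ominus> r) = \<zero>"
    proof -
      have "x \<otimes> (u \<ominus> r) = x \<otimes> u \<ominus> x \<otimes> r" using x(1) carr by algebra
      then show ?thesis using x(1) carr by (simp add: eq minus_eq r_neg)
    qed
    ultimately have "x = \<zero> \<otimes> inv (u \<ominus> r)"
      using x(1) by (metis Units_closed Units_inv_closed Units_r_inv m_assoc r_one)
    then show False using x(2) \<open>u \<ominus> r \<in> Units R\<close> by simp
  qed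
  then have "(\<otimes>) x ` (carrier R - Units R) \<inter> (\<otimes>) x ` Units R = {}"
    by (intro equals0I, elim IntE imageE) metis
  moreover have "(\<otimes>) x ` carrier R = (\<otimes>) x ` (carrier R - Units R) \<union> (\<otimes>) x ` Units R"
    unfolding image_Un[symmetric] by (intro arg_cong[where f = "image _"]) auto
  ultimately show ?thesis
    using x(1) by (simp add: nongenerators_def genideal_singleton_eq_image unit_multiples_def
      Setcompr_eq_image Un_Diff Diff_triv)
qed

text \<open>A set difference shows no closure by itself; as the image of the ideal of nonunits under
  the additive map \<open>r \<mapsto> x r\<close> it is a subgroup.\<close>

lemma nongenerators_additive_subgroup: "additive_subgroup (nongenerators R x) R"
proof -
  interpret M: ideal "carrier R - Units R" R by (rule nonunits_ideal[OF fin])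
  show ?thesis unfolding nongenerators_eq_image
  proof (rule additive_subgroupI, rule add.subgroupI)
    show "(\<otimes>) x ` (carrier R - Units R) \<noteq> {}"
      unfolding image_is_empty using M.zero_closed by (metis empty_iff)
    fix a b assume a: "a \<in> (\<otimes>) x ` (carrier R - Units R)"
    then obtain r where r: "r \<in> carrier R - Units R" "a = x \<otimes> r" by blast
    have "\<ominus> a = x \<otimes> (\<ominus> r)" using r x(1) by (simp add: r_minus)
    then show "\<ominus> a \<in> (\<otimes>) x ` (carrier R - Units R)"
      using M.a_inv_closed[OF r(1)] by (rule image_eqI)
    assume "b \<in> (\<otimes>) x ` (carrier R - Units R)"
    then obtain s where s: "s \<in> carrier R - Units R" "b = x \<otimes> s" by blast
    have "a \<oplus> b = x \<otimes> (r \<oplus> s)" using r s x(1) by (simp add: r_distr)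
    then show "a \<oplus> b \<in> (\<otimes>) x ` (carrier R - Units R)"
      using M.a_closed[OF r(1) s(1)] by (rule image_eqI)
  qed (use x(1) in auto)
qed

lemma unit_multiples_eq_diff: "unit_multiples R x = Idl {x} - nongenerators R x"
proof -
  have "unit_multiples R x \<subseteq> Idl {x}"
    unfolding genideal_singleton_eq_image[OF x(1)] unit_multiples_def using Units_closed by blast
  then show ?thesis unfolding nongenerators_def by blast
qed

end

end

text \<open>For \<open>x = 0\<close> the set \<^const>\<open>nongenerators\<close> is empty; \<open>{0}\<close> in its place lets the same
  formulas cover the factors outside \<open>P\<close>, where the eigenvalue \<open>-1\<close> gets multiplicity \<open>0\<close>.\<close>

definition proper_multiples :: "('a, 'm) ring_scheme \<Rightarrow> 'a \<Rightarrow> 'a set"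
  where "proper_multiples R x = (if x = \<zero>\<^bsub>R\<^esub> then {\<zero>\<^bsub>R\<^esub>} else nongenerators R x)"

definition factor_eigenvalue :: "('a, 'm) ring_scheme \<Rightarrow> 'a \<Rightarrow> nat \<Rightarrow> int"
  where "factor_eigenvalue R x c =
    (if c = 0 then int (card (unit_multiples R x))
     else if c = 1 then - int (card (proper_multiples R x)) else 0)"

text \<open>These are the traces of the chain idempotents for \<open>H = Idl {x}\<close> and
  \<open>K = proper_multiples R x\<close>.\<close>

definition factor_multiplicity :: "('a, 'm) ring_scheme \<Rightarrow> 'a \<Rightarrow> nat \<Rightarrow> real"
  where "factor_multiplicity R x c =
    (let n = real (card (carrier R)); m = real (card (Idl\<^bsub>R\<^esub> {x})); k = real (card (proper_multiples R x))
     in if c = 0 then n / m else if c = 1 then n / k - n / m else n - n / k)"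

section \<open>Spectral sums of a single factor\<close>

context local_ring
begin

context
  fixes x
  assumes fin: "finite (carrier R)" and x: "x \<in> carrier R"
begin

lemma genideal_additive_subgroup: "additive_subgroup (Idl {x}) R"
  using genideal_ideal[of "{x}"] x by (simp add: ideal_def)

lemma proper_multiples_additive_subgroup: "additive_subgroup (proper_multiples R x) R"
proof (cases "x = \<zero>")
  case True
  have "additive_subgroup {\<zero>} R"
    by (intro additive_subgroupI add.triv_subgroup[simplified])
  then show ?thesis using True by (simp add: proper_multiples_def)
next
  case False
  then show ?thesis
    using nongenerators_additive_subgroup[OF fin x] by (simp add: proper_multiples_def)
qed

lemma proper_multiples_subset: "proper_multiples R x \<subseteq> Idl {x}"
  using additive_subgroup.zero_closed[OF genideal_additive_subgroup]
  by (auto simp: proper_multiples_def nongenerators_def)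

lemma card_unit_multiples_nonzero:
  assumes "x \<noteq> \<zero>"
  shows "card (Idl {x}) = card (unit_multiples R x) + card (nongenerators R x)"
proof -
  have "finite (Idl {x})"
    using additive_subgroup.a_subset[OF genideal_additive_subgroup] fin by (rule finite_subset)
  moreover have "nongenerators R x \<subseteq> Idl {x}" by (auto simp: nongenerators_def)
  ultimately show ?thesis
    unfolding unit_multiples_eq_diff[OF fin x assms]
    by (simp add: card_Diff_subset finite_subset card_mono)
qed

lemma card_unit_multiples_pos: "card (unit_multiples R x) > 0"
proof -
  have "unit_multiples R x \<subseteq> carrier R" using x by (auto simp: unit_multiples_def Units_closed)
  then have "finite (unit_multiples R x)" using fin by (rule finite_subset)
  moreover have "unit_multiples R x \<noteq> {}" by (auto simp: unit_multiples_def)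
  ultimately show ?thesis by (simp add: card_gt_0_iff)
qed

lemma genideal_zero_eq: "Idl {\<zero>} = {\<zero>}"
  by (auto simp: genideal_singleton_eq_image)

text \<open>For \<open>x\<close> nonzero the coefficients of \<open>e_I\<close> add up to
  \<open>|xR^*| + |M| = |I|\<close>, leaving \<open>|I| e_I - |M| e_M\<close>, the indicator of
  \<open>I\<close> minus that of \<open>M\<close>. For \<open>x = 0\<close> all the sets are
  \<open>{0}\<close> and only the term \<open>c = 0\<close> survives.\<close>

lemma unit_multiples_kernel_decomposition:
  "(if u \<ominus> v \<in> unit_multiples R x then 1 else 0)
    = (\<Sum>c<3. of_int (factor_eigenvalue R x c) * chain_idempotent R (Idl {x}) (proper_multiples R x) c u v)"
proof (cases "x = \<zero>")
  case True
  then show ?thesis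
    unfolding sum_lessThan_3
    by (simp add: factor_eigenvalue_def chain_idempotent_def proper_multiples_def genideal_zero_eq
      unit_multiples_zero ring_axioms subgroup_kernel_def)
next
  case False
  have pos: "card (nongenerators R x) > 0"
    using card_additive_subgroup_pos[OF fin nongenerators_additive_subgroup[OF fin x False]] .
  have sub: "nongenerators R x \<subseteq> Idl {x}" by (auto simp: nongenerators_def)
  have "card (Idl {x}) \<noteq> 0"
    using card_unit_multiples_nonzero[OF False] pos by simp
  then have nonzero: "(of_nat (card (Idl {x})) :: complex) \<noteq> 0" "(of_nat (card (nongenerators R x)) :: complex) \<noteq> 0"
    using pos unfolding of_nat_eq_0_iff by auto
  have m: "of_nat (card (unit_multiples R x)) + of_nat (card (nongenerators R x)) = (of_nat (card (Idl {x})) :: complex)"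
    by (simp add: card_unit_multiples_nonzero[OF False])
  have "(\<Sum>c<3. of_int (factor_eigenvalue R x c) * chain_idempotent R (Idl {x}) (proper_multiples R x) c u v)
      = of_nat (card (Idl {x})) * subgroup_kernel R (Idl {x}) u v
        - of_nat (card (nongenerators R x)) * subgroup_kernel R (nongenerators R x) u v"
    unfolding sum_lessThan_3 m[symmetric] using False
    by (simp add: factor_eigenvalue_def chain_idempotent_def proper_multiples_def algebra_simps)
  also have "\<dots> = (if u \<ominus> v \<in> unit_multiples R x then 1 else 0)"
    using nonzero sub unfolding unit_multiples_eq_diff[OF fin x False]
    by (auto simp: subgroup_kernel_def)
  finally show ?thesis ..
qed

text \<open>With \<open>m = u + k\<close>, the eigenvalue \<open>-k\<close> has multiplicity
  \<open>n/k - n/m = (n/m) (u/k)\<close>, which is \<open>q\<close> times that of \<open>u\<close>.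
  Its share of the absolute values is \<open>(n/m) u\<close>, the same as the share of
  \<open>u\<close>, whence the factor 2. For \<open>x = 0\<close> this multiplicity is 0, so the
  factor contributes only \<open>r\<close> and \<open>|xR^*| = 1\<close>.\<close>

lemma factor_sums:
  defines "r \<equiv> real (card (carrier R)) / real (card (Idl {x}))"
    and "q \<equiv> real (card (unit_multiples R x)) / real (card (nongenerators R x))"
  shows "(\<Sum>c<3. of_int \<bar>factor_eigenvalue R x c\<bar> * factor_multiplicity R x c)
      = r * real (card (unit_multiples R x)) * (if x \<noteq> \<zero> then 2 else 1)"
    and "(\<Sum>c<3. of_int (sgn (factor_eigenvalue R x c)) * factor_multiplicity R x c)
      = r * (if x \<noteq> \<zero> then 1 - q else 1)"
    and "(\<Sum>c<3. of_int \<bar>sgn (factor_eigenvalue R x c)\<bar> * factor_multiplicity R x c)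
      = r * (if x \<noteq> \<zero> then 1 + q else 1)"
proof -
  define u where "u = real (card (unit_multiples R x))"
  define k where "k = real (card (proper_multiples R x))"
  define n where "n = real (card (carrier R))"
  define m where "m = real (card (Idl {x}))"
  have pos: "u > 0" "k > 0" "m > 0"
    using card_unit_multiples_pos card_additive_subgroup_pos[OF fin proper_multiples_additive_subgroup]
      card_additive_subgroup_pos[OF fin genideal_additive_subgroup]
    by (simp_all add: u_def k_def m_def)
  have sgn: "sgn (factor_eigenvalue R x 0) = 1" "sgn (factor_eigenvalue R x 1) = -1"
    using pos by (simp_all add: factor_eigenvalue_def u_def k_def sgn_if)
  have two: "factor_eigenvalue R x 2 = 0" by (simp add: factor_eigenvalue_def)
  have abs: "of_int \<bar>factor_eigenvalue R x 0\<bar> = u" "of_int \<bar>factor_eigenvalue R x 1\<bar> = k"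
    by (simp_all add: factor_eigenvalue_def u_def k_def)
  have mult: "factor_multiplicity R x 0 = n / m" "factor_multiplicity R x 1 = n / k - n / m"
    by (simp_all add: factor_multiplicity_def Let_def n_def m_def k_def)
  have sums: "(\<Sum>c<3. of_int \<bar>factor_eigenvalue R x c\<bar> * factor_multiplicity R x c) = u * (n / m) + k * (n / k - n / m)"
    "(\<Sum>c<3. of_int (sgn (factor_eigenvalue R x c)) * factor_multiplicity R x c) = n / m - (n / k - n / m)"
    "(\<Sum>c<3. of_int \<bar>sgn (factor_eigenvalue R x c)\<bar> * factor_multiplicity R x c) = n / m + (n / k - n / m)"
    unfolding sum_lessThan_3 sgn two abs mult by simp_all
  have zero: "m = 1" "k = 1" "u = 1" if "x = \<zero>"
    using that by (simp_all add: m_def k_def u_def genideal_zero_eq proper_multiples_def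
      unit_multiples_zero ring_axioms)
  have nonzero: "m = u + k" "q = u / k" if "x \<noteq> \<zero>"
    using that card_unit_multiples_nonzero[OF that]
    by (simp_all add: m_def k_def u_def q_def proper_multiples_def)
  have r: "r = n / m" by (simp add: r_def n_def m_def)
  have diff: "n / k - n / m = n / m * ((m - k) / k)" using pos by (simp add: field_simps)
  show "(\<Sum>c<3. of_int \<bar>factor_eigenvalue R x c\<bar> * factor_multiplicity R x c)
      = r * real (card (unit_multiples R x)) * (if x \<noteq> \<zero> then 2 else 1)"
    unfolding sums diff r u_def[symmetric] using pos zero nonzero(1) by (cases "x = \<zero>") simp_all
  show "(\<Sum>c<3. of_int (sgn (factor_eigenvalue R x c)) * factor_multiplicity R x c)
      = r * (if x \<noteq> \<zero> then 1 - q else 1)"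
    unfolding sums diff r using zero nonzero by (cases "x = \<zero>") (simp_all add: right_diff_distrib)
  show "(\<Sum>c<3. of_int \<bar>sgn (factor_eigenvalue R x c)\<bar> * factor_multiplicity R x c)
      = r * (if x \<noteq> \<zero> then 1 + q else 1)"
    unfolding sums diff r using zero nonzero by (cases "x = \<zero>") (simp_all add: distrib_left)
qed

end

end

section \<open>Finite products of rings\<close>

text \<open>The operations of the list product are accessible only through the binary product of
  head and tail. The projection is therefore checked on pairs and carried over along the
  homomorphism \<open>?h\<close>.\<close>

lemma RDirProd_list_nth_hom:
  assumes "i < length Rs"
  shows "(\<lambda>as. as ! i) \<in> Ring.ring_hom (RDirProd_list Rs) (Rs ! i)"
  using assms
proof (induction Rs arbitrary: i)
  case (Cons S Rs)
  let ?h = "\<lambda>(a, as). a # as" and ?D = "RDirProd S (RDirProd_list Rs)"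
  have carr: "carrier ?D = carrier S \<times> carrier (RDirProd_list Rs)"
    by (simp add: RDirProd_def DirProd_def monoid.defs)
  note h = ring_hom_memE[OF RDirProd_list_hom1[of S Rs]]
  have IH: "(\<lambda>as. as ! j) \<in> Ring.ring_hom (RDirProd_list Rs) (Rs ! j)" if "i = Suc j" for j
    using Cons that by simp
  have comp: "(\<lambda>p. ?h p ! i) \<in> Ring.ring_hom ?D ((S # Rs) ! i)"
  proof (cases i)
    case 0
    then show ?thesis
      by (intro ring_hom_memI) (auto simp: RDirProd_def DirProd_def monoid.defs)
  next
    case (Suc j)
    then show ?thesis
      using ring_hom_memE[OF IH[OF Suc]]
      by (intro ring_hom_memI) (auto simp: RDirProd_def DirProd_def monoid.defs)
  qed
  note c = ring_hom_memE[OF comp]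
  show ?case
  proof (rule ring_hom_memI)
    fix as assume "as \<in> carrier (RDirProd_list (S # Rs))"
    then obtain p where p: "p \<in> carrier ?D" "as = ?h p"
      unfolding RDirProd_list_carrier carr[symmetric] by blast
    show "as ! i \<in> carrier ((S # Rs) ! i)" using c(1)[OF p(1)] by (simp add: p(2))
    fix bs assume "bs \<in> carrier (RDirProd_list (S # Rs))"
    then obtain q where q: "q \<in> carrier ?D" "bs = ?h q"
      unfolding RDirProd_list_carrier carr[symmetric] by blast
    show "(as \<otimes>\<^bsub>RDirProd_list (S # Rs)\<^esub> bs) ! i = as ! i \<otimes>\<^bsub>(S # Rs) ! i\<^esub> bs ! i"
      unfolding p(2) q(2) h(2)[OF p(1) q(1), symmetric] by (rule c(2)[OF p(1) q(1)])
    show "(as \<oplus>\<^bsub>RDirProd_list (S # Rs)\<^esub> bs) ! i = as ! i \<oplus>\<^bsub>(S # Rs) ! i\<^esub> bs ! i"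
      unfolding p(2) q(2) h(3)[OF p(1) q(1), symmetric] by (rule c(3)[OF p(1) q(1)])
  next
    show "\<one>\<^bsub>RDirProd_list (S # Rs)\<^esub> ! i = \<one>\<^bsub>(S # Rs) ! i\<^esub>"
      unfolding h(4)[symmetric] by (rule c(4))
  qed
qed simp

section \<open>Componentwise descriptions in a finite product\<close>

text \<open>The product is given by its projections and a bijection onto extensional functions, so
  that vertices match the \<open>PiE\<close> index sets used for tensor products and lists stay out
  of the argument.\<close>

locale ring_product = R: cring R
  for R :: "('r, 'm) ring_scheme" (structure) +
  fixes I :: "'i set" and S :: "'i \<Rightarrow> ('a, 'n) ring_scheme" and \<pi> :: "'i \<Rightarrow> 'r \<Rightarrow> 'a"
  assumes finite_index: "finite I"
    and factor: "\<And>i. i \<in> I \<Longrightarrow> cring (S i)"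
    and proj: "\<And>i. i \<in> I \<Longrightarrow> \<pi> i \<in> Ring.ring_hom R (S i)"
    and bij: "bij_betw (\<lambda>r. \<lambda>i\<in>I. \<pi> i r) (carrier R) (\<Pi>\<^sub>E i\<in>I. carrier (S i))"
begin

lemma proj_simps:
  assumes "i \<in> I"
  shows "r \<in> carrier R \<Longrightarrow> \<pi> i r \<in> carrier (S i)"
    and "r \<in> carrier R \<Longrightarrow> s \<in> carrier R \<Longrightarrow> \<pi> i (r \<otimes> s) = \<pi> i r \<otimes>\<^bsub>S i\<^esub> \<pi> i s"
    and "r \<in> carrier R \<Longrightarrow> s \<in> carrier R \<Longrightarrow> \<pi> i (r \<oplus> s) = \<pi> i r \<oplus>\<^bsub>S i\<^esub> \<pi> i s"
    and "\<pi> i \<one> = \<one>\<^bsub>S i\<^esub>"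
    and "r \<in> carrier R \<Longrightarrow> s \<in> carrier R \<Longrightarrow> \<pi> i (r \<ominus> s) = \<pi> i r \<ominus>\<^bsub>S i\<^esub> \<pi> i s"
proof -
  interpret Si: cring "S i" by (rule factor[OF assms])
  interpret hom: ring_hom_ring R "S i" "\<pi> i"
    by (rule ring_hom_ringI2[OF R.ring_axioms Si.ring_axioms proj[OF assms]])
  show "r \<in> carrier R \<Longrightarrow> \<pi> i r \<in> carrier (S i)"
    "r \<in> carrier R \<Longrightarrow> s \<in> carrier R \<Longrightarrow> \<pi> i (r \<otimes> s) = \<pi> i r \<otimes>\<^bsub>S i\<^esub> \<pi> i s"
    "r \<in> carrier R \<Longrightarrow> s \<in> carrier R \<Longrightarrow> \<pi> i (r \<oplus> s) = \<pi> i r \<oplus>\<^bsub>S i\<^esub> \<pi> i s"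
    "\<pi> i \<one> = \<one>\<^bsub>S i\<^esub>"
    "r \<in> carrier R \<Longrightarrow> s \<in> carrier R \<Longrightarrow> \<pi> i (r \<ominus> s) = \<pi> i r \<ominus>\<^bsub>S i\<^esub> \<pi> i s"
    by (simp_all add: R.minus_eq Si.minus_eq)
qed

lemma proj_eqI:
  assumes "r \<in> carrier R" "s \<in> carrier R" "\<And>i. i \<in> I \<Longrightarrow> \<pi> i r = \<pi> i s"
  shows "r = s"
  using bij assms unfolding bij_betw_def by (elim conjE) (erule inj_onD, auto intro!: restrict_ext)

lemma proj_surj:
  assumes "\<And>i. i \<in> I \<Longrightarrow> f i \<in> carrier (S i)"
  shows "\<exists>r\<in>carrier R. \<forall>i\<in>I. \<pi> i r = f i"
proof -
  have "restrict f I \<in> (\<lambda>r. \<lambda>i\<in>I. \<pi> i r) ` carrier R"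
    using assms bij by (auto simp: bij_betw_def)
  then obtain r where r: "r \<in> carrier R" "restrict f I = (\<lambda>i\<in>I. \<pi> i r)" by blast
  have "\<pi> i r = f i" if "i \<in> I" for i
    using fun_cong[OF r(2), of i] that by simp
  with r(1) show ?thesis by blast
qed

text \<open>\<open>bij\<close> maps \<open>A\<close> onto the box \<open>PiE I B\<close>. This makes
  \<open>|R|\<close>, \<open>|xR^*|\<close> and \<open>|I_x|\<close> products over the
  factors.\<close>

lemma card_componentwise:
  assumes "A \<subseteq> carrier R" "\<And>i. i \<in> I \<Longrightarrow> B i \<subseteq> carrier (S i)"
    and "\<And>r. r \<in> carrier R \<Longrightarrow> r \<in> A \<longleftrightarrow> (\<forall>i\<in>I. \<pi> i r \<in> B i)"
  shows "card A = (\<Prod>i\<in>I. card (B i))"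
proof -
  have "(\<lambda>r. \<lambda>i\<in>I. \<pi> i r) ` A = PiE I B"
  proof (intro equalityI subsetI)
    fix f assume f: "f \<in> PiE I B"
    then have "\<And>i. i \<in> I \<Longrightarrow> f i \<in> carrier (S i)" using assms(2) by blast
    then obtain r where r: "r \<in> carrier R" "\<And>i. i \<in> I \<Longrightarrow> \<pi> i r = f i"
      using proj_surj[of f] by blast
    have "r \<in> A" using assms(3)[OF r(1)] r(2) f by auto
    moreover have "f = (\<lambda>i\<in>I. \<pi> i r)"
      using f r(2) by (intro ext) (auto simp: PiE_def extensional_def)
    ultimately show "f \<in> (\<lambda>r. \<lambda>i\<in>I. \<pi> i r) ` A" by blast
  next
    fix f assume "f \<in> (\<lambda>r. \<lambda>i\<in>I. \<pi> i r) ` A"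
    then obtain r where "r \<in> A" "f = (\<lambda>i\<in>I. \<pi> i r)" by blast
    then show "f \<in> PiE I B" using assms(1,3) by auto
  qed
  moreover have "inj_on (\<lambda>r. \<lambda>i\<in>I. \<pi> i r) A"
    using bij assms(1) by (auto simp: bij_betw_def intro: inj_on_subset)
  ultimately have "card A = card (PiE I B)" using card_image by metis
  then show ?thesis by (simp add: card_PiE finite_index)
qed

lemma Units_componentwise:
  assumes "r \<in> carrier R"
  shows "r \<in> Units R \<longleftrightarrow> (\<forall>i\<in>I. \<pi> i r \<in> Units (S i))"
proof
  assume "r \<in> Units R"
  then obtain s where s: "s \<in> carrier R" "s \<otimes> r = \<one>" "r \<otimes> s = \<one>" by (auto simp: Units_def)
  show "\<forall>i\<in>I. \<pi> i r \<in> Units (S i)"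
  proof
    fix i assume i: "i \<in> I"
    have "\<pi> i s \<otimes>\<^bsub>S i\<^esub> \<pi> i r = \<one>\<^bsub>S i\<^esub>" "\<pi> i r \<otimes>\<^bsub>S i\<^esub> \<pi> i s = \<one>\<^bsub>S i\<^esub>"
      using s proj_simps(2)[OF i s(1) assms] proj_simps(2)[OF i assms s(1)] proj_simps(4)[OF i] by metis+
    then show "\<pi> i r \<in> Units (S i)"
      using s(1) assms i unfolding Units_def by (auto intro: proj_simps(1))
  qed
next
  assume u: "\<forall>i\<in>I. \<pi> i r \<in> Units (S i)"
  have "inv\<^bsub>S i\<^esub> (\<pi> i r) \<in> carrier (S i)" if "i \<in> I" for i
  proof -
    interpret Si: cring "S i" by (rule factor[OF that])
    show ?thesis using u that by blast
  qed
  then obtain s where s: "s \<in> carrier R" "\<And>i. i \<in> I \<Longrightarrow> \<pi> i s = inv\<^bsub>S i\<^esub> (\<pi> i r)"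
    using proj_surj[of "\<lambda>i. inv\<^bsub>S i\<^esub> (\<pi> i r)"] by blast
  have "s \<otimes> r = \<one>"
  proof (rule proj_eqI)
    fix i assume i: "i \<in> I"
    interpret Si: cring "S i" by (rule factor[OF i])
    show "\<pi> i (s \<otimes> r) = \<pi> i \<one>" using u i s assms by (simp add: proj_simps)
  qed (use s assms in auto)
  moreover from this have "r \<otimes> s = \<one>" using R.m_comm[OF s(1) assms] by simp
  ultimately show "r \<in> Units R" using s(1) assms unfolding Units_def by blast
qed

text \<open>For the converse, unit multipliers are chosen in each factor separately and glued by
  \<open>proj_surj\<close>; the glued element is a unit because units are detected
  componentwise.\<close>

lemma unit_multiples_componentwise:
  assumes "x \<in> carrier R" "r \<in> carrier R"
  shows "r \<in> unit_multiples R x \<longleftrightarrow> (\<forall>i\<in>I. \<pi> i r \<in> unit_multiples (S i) (\<pi> i x))"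
proof
  assume "r \<in> unit_multiples R x"
  then obtain u where "u \<in> Units R" "r = x \<otimes> u" by (auto simp: unit_multiples_def)
  then show "\<forall>i\<in>I. \<pi> i r \<in> unit_multiples (S i) (\<pi> i x)"
    using assms(1) Units_componentwise[of u] by (auto simp: unit_multiples_def proj_simps R.Units_closed)
next
  assume "\<forall>i\<in>I. \<pi> i r \<in> unit_multiples (S i) (\<pi> i x)"
  then have "\<forall>i\<in>I. \<exists>u. u \<in> Units (S i) \<and> \<pi> i r = \<pi> i x \<otimes>\<^bsub>S i\<^esub> u"
    by (auto simp: unit_multiples_def)
  then obtain f where f: "\<And>i. i \<in> I \<Longrightarrow> f i \<in> Units (S i) \<and> \<pi> i r = \<pi> i x \<otimes>\<^bsub>S i\<^esub> f i"
    by metis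
  then have "\<And>i. i \<in> I \<Longrightarrow> f i \<in> carrier (S i)" by (auto simp: Units_def)
  then obtain u where u: "u \<in> carrier R" "\<And>i. i \<in> I \<Longrightarrow> \<pi> i u = f i"
    using proj_surj[of f] by blast
  have "u \<in> Units R" using f u by (simp add: Units_componentwise)
  moreover have "r = x \<otimes> u"
    by (rule proj_eqI) (use assms f u in \<open>auto simp: proj_simps\<close>)
  ultimately show "r \<in> unit_multiples R x" by (auto simp: unit_multiples_def)
qed

lemma genideal_componentwise:
  assumes "x \<in> carrier R" "r \<in> carrier R"
  shows "r \<in> Idl {x} \<longleftrightarrow> (\<forall>i\<in>I. \<pi> i r \<in> Idl\<^bsub>S i\<^esub> {\<pi> i x})"
proof -
  have Idl: "Idl\<^bsub>S i\<^esub> {\<pi> i x} = (\<lambda>s. \<pi> i x \<otimes>\<^bsub>S i\<^esub> s) ` carrier (S i)" if "i \<in> I" for i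
    using cring.genideal_singleton_eq_image[OF factor[OF that] proj_simps(1)[OF that assms(1)]] .
  show ?thesis
  proof
    assume "r \<in> Idl {x}"
    then obtain s where "s \<in> carrier R" "r = x \<otimes> s"
      using assms(1) by (auto simp: R.genideal_singleton_eq_image)
    then show "\<forall>i\<in>I. \<pi> i r \<in> Idl\<^bsub>S i\<^esub> {\<pi> i x}"
      using assms(1) by (auto simp: Idl proj_simps)
  next
    assume "\<forall>i\<in>I. \<pi> i r \<in> Idl\<^bsub>S i\<^esub> {\<pi> i x}"
    then have "\<forall>i\<in>I. \<exists>s. s \<in> carrier (S i) \<and> \<pi> i r = \<pi> i x \<otimes>\<^bsub>S i\<^esub> s"
      by (auto simp: Idl)
    then obtain f where f: "\<And>i. i \<in> I \<Longrightarrow> f i \<in> carrier (S i) \<and> \<pi> i r = \<pi> i x \<otimes>\<^bsub>S i\<^esub> f i"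
      by metis
    then obtain s where s: "s \<in> carrier R" "\<And>i. i \<in> I \<Longrightarrow> \<pi> i s = f i"
      using proj_surj[of f] by blast
    have "r = x \<otimes> s"
      by (rule proj_eqI) (use assms f s in \<open>auto simp: proj_simps\<close>)
    then show "r \<in> Idl {x}" using assms(1) s(1) by (auto simp: R.genideal_singleton_eq_image)
  qed
qed

theorem graph_energy_complement_cayley:
  assumes local: "\<And>i. i \<in> I \<Longrightarrow> local_ring (S i)"
    and fin: "\<And>i. i \<in> I \<Longrightarrow> finite (carrier (S i))"
    and x: "x \<in> carrier R" "x \<noteq> \<zero>"
    and P: "P = {i \<in> I. \<pi> i x \<noteq> \<zero>\<^bsub>S i\<^esub>}"
  shows "graph_energy (graph_complement (cayley_graph R (unit_multiples R x))) =
      2 * (real (card (carrier R)) - real (card (unit_multiples R x)) - 1)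
      + real (card (carrier R)) / real (card (Idl {x}))
        * (2 ^ card P * real (card (unit_multiples R x))
           + (\<Prod>i\<in>P. 1 - real (card (unit_multiples (S i) (\<pi> i x)))
                        / real (card (nongenerators (S i) (\<pi> i x))))
           - (\<Prod>i\<in>P. 1 + real (card (unit_multiples (S i) (\<pi> i x)))
                        / real (card (nongenerators (S i) (\<pi> i x)))))"
proof -
  define f where "f r = (\<lambda>i\<in>I. \<pi> i r)" for r
  have f: "inj_on f (carrier R)" "f ` carrier R = (\<Pi>\<^sub>E i\<in>I. carrier (S i))"
    using bij unfolding bij_betw_def f_def by auto
  have "finite (f ` carrier R)"
    unfolding f(2) by (rule finite_PiE[OF finite_index fin])
  then have finR: "finite (carrier R)" using f(1) by (rule finite_imageD)
  obtain vs where vs: "set vs = carrier R" "distinct vs"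
    using finite_distinct_list[OF finR] by blast
  \<comment> \<open>The vertices are renamed to tuples in the same order, so the two matrices below
    agree entry by entry.\<close>
  define ws where "ws = map f vs"
  have ws: "distinct ws" "set ws = (\<Pi>\<^sub>E i\<in>I. carrier (S i))"
    using vs f by (simp_all add: ws_def distinct_map)
  have px: "\<pi> i x \<in> carrier (S i)" if "i \<in> I" for i using that x(1) by (rule proj_simps(1))
  have factor_ring: "ring (S i)" if "i \<in> I" for i using factor[OF that] by (simp add: cring_def)
  define U where "U i = unit_multiples (S i) (\<pi> i x)" for i
  define H where "H i = Idl\<^bsub>S i\<^esub> {\<pi> i x}" for i
  define K where "K i = proper_multiples (S i) (\<pi> i x)" for i
  define a :: "'i \<Rightarrow> 'a \<Rightarrow> 'a \<Rightarrow> complex"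
    where "a i u v = (if u \<ominus>\<^bsub>S i\<^esub> v \<in> U i then 1 else 0)" for i u v
  have unit_carrier: "unit_multiples R x \<subseteq> carrier R"
    using x(1) by (auto simp: unit_multiples_def R.Units_closed)
  \<comment> \<open>Used twice: it makes the diagonal of the complement zero, and it leaves room for
    the bound on the degree.\<close>
  have zero_notin: "\<zero> \<notin> unit_multiples R x"
  proof
    assume "\<zero> \<in> unit_multiples R x"
    then obtain u where u: "u \<in> Units R" "\<zero> = x \<otimes> u" by (auto simp: unit_multiples_def)
    then have "x = \<zero> \<otimes> inv u" using x(1) by (simp add: R.m_assoc R.Units_closed)
    then show False using x(2) u(1) by simp
  qed
  \<comment> \<open>The Cayley kernel is the tensor product of its factors because membership in
    \<open>xR^*\<close> is componentwise.\<close>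
  have a_prod: "(\<Prod>i\<in>I. a i (f r i) (f s i)) = (if r \<ominus> s \<in> unit_multiples R x then 1 else 0)"
    if "r \<in> carrier R" "s \<in> carrier R" for r s
    using that x(1)
    by (simp add: a_def f_def U_def prod_if_zero[OF finite_index] unit_multiples_componentwise
      proj_simps(5))
  have adjacency: "adjacency_matrix (graph_complement (cayley_graph R (unit_multiples R x))) vs
      = kernel_matrix (\<lambda>u v. (if u = v then 0 else 1) - (\<Prod>i\<in>I. a i (u i) (v i))) ws"
  proof -
    have entry: "(if (r, s) \<in> parcs (graph_complement (cayley_graph R (unit_multiples R x))) then 1 else 0)
        = (if f r = f s then 0 else 1) - (\<Prod>i\<in>I. a i (f r i) (f s i))"
      if "r \<in> set vs" "s \<in> set vs" for r s
    proof -
      have carr: "r \<in> carrier R" "s \<in> carrier R" using that vs(1) by auto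
      have "f r = f s \<longleftrightarrow> r = s" using f(1) carr by (auto dest: inj_onD)
      moreover have "s \<ominus> s \<notin> unit_multiples R x"
        using carr(2) zero_notin by (simp add: R.minus_eq R.r_neg)
      ultimately show ?thesis
        using carr unfolding a_prod[OF carr]
        by (auto simp: graph_complement_def cayley_graph_def)
    qed
    show ?thesis
      unfolding adjacency_matrix_def kernel_matrix_def ws_def
      by (rule cong_mat) (simp_all add: entry)
  qed
  have energy: "graph_energy (graph_complement (cayley_graph R (unit_multiples R x)))
      = matrix_energy (adjacency_matrix (graph_complement (cayley_graph R (unit_multiples R x))) vs)"
    by (rule graph_energy_eq) (use vs in \<open>simp_all add: graph_complement_def cayley_graph_def\<close>)
  have product: "matrix_energy
      (kernel_matrix (\<lambda>u v. (if u = v then 0 else 1) - (\<Prod>i\<in>I. a i (u i) (v i))) ws)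
    = \<bar>(\<Prod>i\<in>I. real (card (carrier (S i)))) - 1
        - real_of_int (\<Prod>i\<in>I. factor_eigenvalue (S i) (\<pi> i x) 0)\<bar>
      - \<bar>1 + real_of_int (\<Prod>i\<in>I. factor_eigenvalue (S i) (\<pi> i x) 0)\<bar>
      + (\<Prod>i\<in>I. real (card (carrier (S i))))
      + (\<Prod>i\<in>I. \<Sum>c\<in>{..<3}. of_int \<bar>factor_eigenvalue (S i) (\<pi> i x) c\<bar> * factor_multiplicity (S i) (\<pi> i x) c)
      + (\<Prod>i\<in>I. \<Sum>c\<in>{..<3}. of_int (sgn (factor_eigenvalue (S i) (\<pi> i x) c)) * factor_multiplicity (S i) (\<pi> i x) c)
      - (\<Prod>i\<in>I. \<Sum>c\<in>{..<3}. of_int \<bar>sgn (factor_eigenvalue (S i) (\<pi> i x) c)\<bar> * factor_multiplicity (S i) (\<pi> i x) c)"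
  proof (rule matrix_energy_product_complement[OF finite_index _ _ ws(1,2),
      where E = "\<lambda>i. chain_idempotent (S i) (H i) (K i)"])
    fix i assume i: "i \<in> I"
    note loc = local[OF i] fin[OF i] px[OF i]
    note chain = fin[OF i] local_ring.genideal_additive_subgroup[OF loc]
      local_ring.proper_multiples_additive_subgroup[OF loc] local_ring.proper_multiples_subset[OF loc]
    show "finite (carrier (S i))" by (rule fin[OF i])
    show "carrier (S i) \<noteq> {}" using px[OF i] by blast
    show "a i u v = (\<Sum>c<3. of_int (factor_eigenvalue (S i) (\<pi> i x) c) * chain_idempotent (S i) (H i) (K i) c u v)"
      for u v
      unfolding a_def U_def H_def K_def by (rule local_ring.unit_multiples_kernel_decomposition[OF loc])
    show "(\<Sum>c<3. chain_idempotent (S i) (H i) (K i) c u v) = (if u = v then 1 else 0)"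
      if "u \<in> carrier (S i)" "v \<in> carrier (S i)" for u v
      unfolding H_def K_def by (rule ring.sum_chain_idempotent[OF factor_ring[OF i] chain that])
    show "(\<Sum>w\<in>carrier (S i). chain_idempotent (S i) (H i) (K i) s u w * chain_idempotent (S i) (H i) (K i) c w v)
        = (if s = c then chain_idempotent (S i) (H i) (K i) s u v else 0)"
      if "s \<in> {..<3}" "c \<in> {..<3}" "u \<in> carrier (S i)" "v \<in> carrier (S i)" for s c u v
      unfolding H_def K_def
      by (rule ring.chain_idempotent_orthogonal[OF factor_ring[OF i] chain]) (use that in auto)
    show "(\<Sum>w\<in>carrier (S i). chain_idempotent (S i) (H i) (K i) c u w) = (if c = 0 then 1 else 0)"
      if "u \<in> carrier (S i)" for c u
      unfolding H_def K_def by (rule ring.chain_idempotent_row[OF factor_ring[OF i] chain that])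
    show "(\<Sum>w\<in>carrier (S i). chain_idempotent (S i) (H i) (K i) c w v) = (if c = 0 then 1 else 0)"
      if "v \<in> carrier (S i)" for c v
      unfolding H_def K_def by (rule ring.chain_idempotent_col[OF factor_ring[OF i] chain that])
    show "(\<Sum>v\<in>carrier (S i). chain_idempotent (S i) (H i) (K i) c v v)
        = of_real (factor_multiplicity (S i) (\<pi> i x) c)" for c
      unfolding H_def K_def ring.chain_idempotent_trace[OF factor_ring[OF i] chain]
      by (simp add: factor_multiplicity_def Let_def)
  qed simp_all
  have n: "(\<Prod>i\<in>I. real (card (carrier (S i)))) = real (card (carrier R))"
    using card_componentwise[of "carrier R" "\<lambda>i. carrier (S i)"] proj_simps(1) by simp
  have k: "(\<Prod>i\<in>I. card (U i)) = card (unit_multiples R x)"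
  proof (rule card_componentwise[symmetric])
    show "U i \<subseteq> carrier (S i)" if "i \<in> I" for i
    proof -
      interpret cring "S i" by (rule factor[OF that])
      show ?thesis using px[OF that] by (auto simp: U_def unit_multiples_def Units_closed)
    qed
  qed (use unit_carrier x(1) in \<open>auto simp: U_def unit_multiples_componentwise\<close>)
  have m: "(\<Prod>i\<in>I. card (H i)) = card (Idl {x})"
  proof (rule card_componentwise[symmetric])
    show "H i \<subseteq> carrier (S i)" if "i \<in> I" for i
      unfolding H_def
      using local_ring.genideal_additive_subgroup[OF local[OF that] fin[OF that] px[OF that]]
      by (rule additive_subgroup.a_subset)
    show "Idl {x} \<subseteq> carrier R"
      using x(1) by (auto simp: R.genideal_singleton_eq_image)
  qed (use x(1) in \<open>auto simp: H_def genideal_componentwise\<close>)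
  have bound: "card (unit_multiples R x) + 1 \<le> card (carrier R)"
  proof -
    have "card (insert \<zero> (unit_multiples R x)) \<le> card (carrier R)"
      using unit_carrier by (intro card_mono finR) auto
    then show ?thesis using zero_notin finite_subset[OF unit_carrier finR] by simp
  qed
  \<comment> \<open>Index 0 in every factor is the part that carries the constant functions, so the
    eigenvalue there is the degree of the Cayley graph.\<close>
  have degree: "real_of_int (\<Prod>i\<in>I. factor_eigenvalue (S i) (\<pi> i x) 0) = real (card (unit_multiples R x))"
    by (simp add: factor_eigenvalue_def flip: k U_def)
  \<comment> \<open>Factors outside \<open>P\<close> contribute 1, which shrinks the product from
    \<open>I\<close> to \<open>P\<close>.\<close>
  have prods: "(\<Prod>i\<in>I. r i * (if \<pi> i x \<noteq> \<zero>\<^bsub>S i\<^esub> then g i else 1))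
      = (\<Prod>i\<in>I. r i) * (\<Prod>i\<in>P. g i)" for r g :: "'i \<Rightarrow> real"
    unfolding P prod.distrib prod.inter_filter[OF finite_index] ..
  define r where "r i = real (card (carrier (S i))) / real (card (H i))" for i
  have r: "(\<Prod>i\<in>I. r i) = real (card (carrier R)) / real (card (Idl {x}))"
    unfolding r_def prod_dividef n by (simp flip: m)
  have abs_sum: "(\<Prod>i\<in>I. \<Sum>c\<in>{..<3}. of_int \<bar>factor_eigenvalue (S i) (\<pi> i x) c\<bar> * factor_multiplicity (S i) (\<pi> i x) c)
      = real (card (carrier R)) / real (card (Idl {x})) * (2 ^ card P * real (card (unit_multiples R x)))"
  proof -
    have "(\<Prod>i\<in>I. \<Sum>c\<in>{..<3}. of_int \<bar>factor_eigenvalue (S i) (\<pi> i x) c\<bar> * factor_multiplicity (S i) (\<pi> i x) c)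
        = (\<Prod>i\<in>I. r i * real (card (U i)) * (if \<pi> i x \<noteq> \<zero>\<^bsub>S i\<^esub> then 2 else 1))"
      unfolding r_def H_def U_def
      by (intro prod.cong refl local_ring.factor_sums(1) local fin px)
    also have "\<dots> = (\<Prod>i\<in>I. r i * real (card (U i))) * (\<Prod>i\<in>P. 2)"
      by (rule prods)
    finally show ?thesis
      unfolding prod.distrib r by (simp flip: k)
  qed
  have sgn_sum: "(\<Prod>i\<in>I. \<Sum>c\<in>{..<3}. of_int (sgn (factor_eigenvalue (S i) (\<pi> i x) c)) * factor_multiplicity (S i) (\<pi> i x) c)
      = real (card (carrier R)) / real (card (Idl {x}))
        * (\<Prod>i\<in>P. 1 - real (card (unit_multiples (S i) (\<pi> i x))) / real (card (nongenerators (S i) (\<pi> i x))))"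
    unfolding r[symmetric] prods[symmetric] r_def H_def
    by (intro prod.cong refl local_ring.factor_sums(2) local fin px)
  have abs_sgn_sum: "(\<Prod>i\<in>I. \<Sum>c\<in>{..<3}. of_int \<bar>sgn (factor_eigenvalue (S i) (\<pi> i x) c)\<bar> * factor_multiplicity (S i) (\<pi> i x) c)
      = real (card (carrier R)) / real (card (Idl {x}))
        * (\<Prod>i\<in>P. 1 + real (card (unit_multiples (S i) (\<pi> i x))) / real (card (nongenerators (S i) (\<pi> i x))))"
    unfolding r[symmetric] prods[symmetric] r_def H_def
    by (intro prod.cong refl local_ring.factor_sums(3) local fin px)
  \<comment> \<open>With \<open>n = |R|\<close> and \<open>k = |xR^*|\<close>, the terms outside the
    three products become \<open>(n - 1 - k) - (1 + k) + n = 2 (n - k - 1)\<close>.\<close>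
  have "\<bar>real (card (carrier R)) - 1 - real (card (unit_multiples R x))\<bar>
      = real (card (carrier R)) - 1 - real (card (unit_multiples R x))"
    using bound by linarith
  then show ?thesis
    unfolding energy adjacency product n degree abs_sum sgn_sum abs_sgn_sum
    by (simp add: distrib_left right_diff_distrib)
qed

end

section \<open>From list products of local rings to indexed projections\<close>

theorem theorem4p1:
  fixes R :: "('r, 'm) ring_scheme"
    and Rs :: "('a, 'n) ring_scheme list"
    and h :: "'r \<Rightarrow> 'a list"
    and x :: 'r
    and P :: "nat set"
  assumes "cring R" and "finite (carrier R)"
    and "\<And>i. i < length Rs \<Longrightarrow> local_ring (Rs ! i)"
    and "\<And>i. i < length Rs \<Longrightarrow> finite (carrier (Rs ! i))"
    and "h \<in> ring_iso R (RDirProd_list Rs)"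
    and "x \<in> carrier R" and "x \<noteq> \<zero>\<^bsub>R\<^esub>"
    and P: "P = {i. i < length Rs \<and> h x ! i \<noteq> \<zero>\<^bsub>Rs ! i\<^esub>}"
  shows "graph_energy (graph_complement (cayley_graph R (unit_multiples R x))) =
      2 * (real (card (carrier R)) - real (card (unit_multiples R x)) - 1)
      + real (card (carrier R)) / real (card (Idl\<^bsub>R\<^esub> {x}))
        * (2 ^ card P * real (card (unit_multiples R x))
           + (\<Prod>i\<in>P. 1 - real (card (unit_multiples (Rs ! i) (h x ! i)))
                        / real (card (nongenerators (Rs ! i) (h x ! i))))
           - (\<Prod>i\<in>P. 1 + real (card (unit_multiples (Rs ! i) (h x ! i)))
                        / real (card (nongenerators (Rs ! i) (h x ! i)))))"
proof -
  have hom: "h \<in> Ring.ring_hom R (RDirProd_list Rs)" and bij: "bij_betw h (carrier R) (carrier (RDirProd_list Rs))"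
    using assms(5) by (auto simp: ring_iso_def)
  \<comment> \<open>Lists of the right length correspond to extensional functions on their indices;
    composing with \<open>h\<close> gives the bijection required by
    \<open>ring_product\<close>.\<close>
  have "bij_betw (\<lambda>as. \<lambda>i\<in>{..<length Rs}. as ! i) (carrier (RDirProd_list Rs))
      (\<Pi>\<^sub>E i\<in>{..<length Rs}. carrier (Rs ! i))"
  proof (rule bij_betw_byWitness[where f' = "\<lambda>g. map g [0..<length Rs]"])
    show "\<forall>as\<in>carrier (RDirProd_list Rs). map (\<lambda>i\<in>{..<length Rs}. as ! i) [0..<length Rs] = as"
    proof
      fix as assume "as \<in> carrier (RDirProd_list Rs)"
      then have "length as = length Rs" by (rule RDirProd_list_carrier_mem(1))
      then show "map (\<lambda>i\<in>{..<length Rs}. as ! i) [0..<length Rs] = as"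
        by (intro nth_equalityI) auto
    qed
    show "\<forall>g\<in>\<Pi>\<^sub>E i\<in>{..<length Rs}. carrier (Rs ! i). (\<lambda>i\<in>{..<length Rs}. map g [0..<length Rs] ! i) = g"
      by (auto simp: PiE_def extensional_def restrict_def)
    show "(\<lambda>as. \<lambda>i\<in>{..<length Rs}. as ! i) ` carrier (RDirProd_list Rs) \<subseteq> (\<Pi>\<^sub>E i\<in>{..<length Rs}. carrier (Rs ! i))"
    proof (rule image_subsetI)
      fix as assume "as \<in> carrier (RDirProd_list Rs)"
      from RDirProd_list_carrier_mem(2)[OF this]
      show "(\<lambda>i\<in>{..<length Rs}. as ! i) \<in> (\<Pi>\<^sub>E i\<in>{..<length Rs}. carrier (Rs ! i))"
        by (simp add: restrict_PiE_iff)
    qed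
    show "(\<lambda>g. map g [0..<length Rs]) ` (\<Pi>\<^sub>E i\<in>{..<length Rs}. carrier (Rs ! i)) \<subseteq> carrier (RDirProd_list Rs)"
    proof (rule image_subsetI)
      fix g assume g: "g \<in> (\<Pi>\<^sub>E i\<in>{..<length Rs}. carrier (Rs ! i))"
      show "map g [0..<length Rs] \<in> carrier (RDirProd_list Rs)"
        by (rule RDirProd_list_carrier_memI) (use g in auto)
    qed
  qed
  from bij_betw_trans[OF bij this]
  have bij': "bij_betw (\<lambda>r. \<lambda>i\<in>{..<length Rs}. h r ! i) (carrier R) (\<Pi>\<^sub>E i\<in>{..<length Rs}. carrier (Rs ! i))"
    by (simp add: o_def)
  interpret ring_product R "{..<length Rs}" "\<lambda>i. Rs ! i" "\<lambda>i r. h r ! i"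
  proof (intro ring_product.intro ring_product_axioms.intro)
    show "(\<lambda>r. h r ! i) \<in> Ring.ring_hom R (Rs ! i)" if "i \<in> {..<length Rs}" for i
      using ring_hom_trans[OF hom RDirProd_list_nth_hom[of i Rs]] that by (simp add: o_def)
  qed (use assms bij' in \<open>auto simp: local_ring_def\<close>)
  show ?thesis
  proof (rule graph_energy_complement_cayley)
    show "P = {i \<in> {..<length Rs}. h x ! i \<noteq> \<zero>\<^bsub>Rs ! i\<^esub>}"
      unfolding P by simp
  qed (simp_all add: assms(3,4,6,7))
qed

end
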